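(* There exists a partially hyperbolic endomorphism $f:\mathbb{T}^2\to\mathbb{T}^2$ which is homotopic to an expanding linear map and whose centre direction $E^c$ is not uniquely integrable. Moreover, $f$ can be taken such that $E^c$ is uniquely integrable on an open and dense subset of $\mathbb{T}^2$, but is not uniquely integrable at each point in a countably infinite family of circles in $\mathbb{T}^2$.
   Context: $\mathbb{T}^2=\mathbb{R}^2/\mathbb{Z}^2$. A linear map $A:\mathbb{T}^2\to\mathbb{T}^2$ is a map induced by an invertible (nonzero determinant) $2\times 2$ integer matrix; it is expanding if both eigenvalues of the matrix have modulus greater than $1$. Cone families: on a surface $M$, a cone family $\mathcal{C}$ is a choice at each $p\in M$ of a closed cone $\mathcal{C}(p)=\{v\in T_pM: Q_p(v)\ge 0\}$, where $Q_p$ is a nondegenerate indefinite quadratic form on $T_pM$ depending continuously on $p$. It is $Df$-invariant if $D_pf(\mathcal{C}(p))$ is contained in the interior of $\mathcal{C}(f(p))$ (apart from the zero vector) for all $p\in M$. A map $f:M\to M$ is a (weakly) partially hyperbolic endomorphism if it is a ($C^1$) local diffeomorphism and there is a $Df$-invariant cone family $\mathcal{C}^u$ and $k>0$ such that $\|Df^k v^u\|>1$ for all unit vectors $v^u\in\mathcal{C}^u$. Such an $f$ has a centre direction $E^c$: the continuous $Df$-invariant line field in $TM$ with $E^c(p)\cap \mathcal{C}^u(p)=\{0\}$ for all $p$. $E^c$ is uniquely integrable at a point $p$ if there is a unique $C^1$ curve tangent to $E^c$ through $p$ (i.e. any two $C^1$ curves tangent to $E^c$ through $p$ coincide near $p$,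 up to reparametrisation); it is uniquely integrable on a set if it is so at every point of the set, and uniquely integrable if it is so at every point of $M$. *)

theory Defs
  imports "HOL-Analysis.Analysis"
begin

section \<open>The torus\<close>

definition same_mod_lattice :: "real^2 \<Rightarrow> real^2 \<Rightarrow> bool" where
  "same_mod_lattice x y \<longleftrightarrow> (\<forall>i. x $ i - y $ i \<in> \<int>)"

lemma equivp_same_mod_lattice: "equivp same_mod_lattice"
proof (rule equivpI)
  show "reflp same_mod_lattice"
    by (simp add: reflp_def same_mod_lattice_def)
  show "symp same_mod_lattice"
    unfolding symp_def same_mod_lattice_def by (metis Ints_minus minus_diff_eq)
  show "transp same_mod_lattice"
  proof (unfold transp_def same_mod_lattice_def, intro allI impI)
    fix x y z :: "real^2" and i
    assume "\<forall>i. x $ i - y $ i \<in> \<int>" "\<forall>i. y $ i - z $ i \<in> \<int>"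
    then have "(x $ i - y $ i) + (y $ i - z $ i) \<in> \<int>"
      by (intro Ints_add) auto
    then show "x $ i - z $ i \<in> \<int>" by simp
  qed
qed

quotient_type torus = "real^2" / same_mod_lattice
  morphisms torus_rep torus_proj
  by (rule equivp_same_mod_lattice)

text \<open>The quotient topology.\<close>

instantiation torus :: topological_space
begin

definition open_torus :: "torus set \<Rightarrow> bool" where
  "open_torus U \<longleftrightarrow> open (torus_proj -` U)"

instance
  by standard (auto simp: open_torus_def vimage_Union)

end

section \<open>Derivatives\<close>

text \<open>
  The tangent bundle is trivialised by the projection, so every tangent space is the plane
  with its Euclidean norm.  Derivatives are taken in local lifts.  A lift which is
  differentiable at a point is continuous there, hence is determined near that point up to
  a lattice translation, so the derivative does not depend on the lift.
\<close>

definition torus_has_deriv :: "(torus \<Rightarrow> torus) \<Rightarrow> real^2^2 \<Rightarrow> torus \<Rightarrow> bool" where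
  "torus_has_deriv f D p \<longleftrightarrow>
     (\<exists>x F. torus_proj x = p \<and>
        (\<forall>\<^sub>F y in nhds x. torus_proj (F y) = f (torus_proj y)) \<and>
        (F has_derivative (\<lambda>v. D *v v)) (at x))"

definition torus_deriv :: "(torus \<Rightarrow> torus) \<Rightarrow> torus \<Rightarrow> real^2^2" where
  "torus_deriv f p = (THE D. torus_has_deriv f D p)"

definition torus_C1_on :: "torus set \<Rightarrow> (torus \<Rightarrow> torus) \<Rightarrow> bool" where
  "torus_C1_on U f \<longleftrightarrow>
     (\<exists>D. continuous_on U D \<and> (\<forall>p\<in>U. torus_has_deriv f (D p) p))"

definition torus_local_diffeo :: "(torus \<Rightarrow> torus) \<Rightarrow> bool" where
  "torus_local_diffeo f \<longleftrightarrow>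
     (\<forall>p. \<exists>U g. open U \<and> p \<in> U \<and> open (f ` U) \<and> torus_C1_on U f \<and>
        torus_C1_on (f ` U) g \<and> (\<forall>q\<in>U. g (f q) = q))"

definition curve_has_velocity :: "(real \<Rightarrow> torus) \<Rightarrow> real^2 \<Rightarrow> real \<Rightarrow> bool" where
  "curve_has_velocity \<gamma> v t \<longleftrightarrow>
     (\<exists>c. (\<forall>\<^sub>F s in nhds t. torus_proj (c s) = \<gamma> s) \<and> (c has_vector_derivative v) (at t))"

section \<open>Linear maps of the torus\<close>

lift_definition toral_linear_map :: "int^2^2 \<Rightarrow> torus \<Rightarrow> torus"
  is "\<lambda>A x. map_matrix of_int A *v x"
proof -
  fix A :: "int^2^2" and x y :: "real^2"
  assume *: "same_mod_lattice x y"
  have "(map_matrix of_int A *v x) $ i - (map_matrix of_int A *v y) $ i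
      = (\<Sum>j\<in>UNIV. of_int (A $ i $ j) * (x $ j - y $ j))" for i
    by (simp add: matrix_vector_mult_def map_matrix_def sum_subtractf right_diff_distrib)
  moreover have "(\<Sum>j\<in>UNIV. of_int (A $ i $ j) * (x $ j - y $ j)) \<in> \<int>" for i
    using * by (intro Ints_sum Ints_mult) (auto simp: same_mod_lattice_def)
  ultimately show "same_mod_lattice (map_matrix of_int A *v x) (map_matrix of_int A *v y)"
    by (simp add: same_mod_lattice_def)
qed

definition expanding_matrix :: "int^2^2 \<Rightarrow> bool" where
  "expanding_matrix A \<longleftrightarrow>
     (\<forall>\<mu>::complex. (\<exists>v. v \<noteq> 0 \<and> map_matrix of_int A *v v = \<mu> *s v) \<longrightarrow> cmod \<mu> > 1)"

definition expanding_linear_map :: "(torus \<Rightarrow> torus) \<Rightarrow> bool" where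
  "expanding_linear_map L \<longleftrightarrow>
     (\<exists>A. det A \<noteq> 0 \<and> expanding_matrix A \<and> L = toral_linear_map A)"

section \<open>Partial hyperbolicity\<close>

text \<open>
  The symmetric matrix \<open>B p\<close> represents the quadratic form on the tangent space at \<open>p\<close>.
\<close>

definition cone_family :: "(torus \<Rightarrow> (real^2) set) \<Rightarrow> bool" where
  "cone_family C \<longleftrightarrow>
     (\<exists>B :: torus \<Rightarrow> real^2^2. continuous_on UNIV B \<and>
        (\<forall>p. transpose (B p) = B p \<and> invertible (B p) \<and>
             (\<exists>v. v \<bullet> (B p *v v) > 0) \<and> (\<exists>v. v \<bullet> (B p *v v) < 0) \<and>
             C p = {v. v \<bullet> (B p *v v) \<ge> 0}))"

definition invariant_cone_family :: "(torus \<Rightarrow> torus) \<Rightarrow> (torus \<Rightarrow> (real^2) set) \<Rightarrow> bool" where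
  "invariant_cone_family f C \<longleftrightarrow> cone_family C \<and>
     (\<forall>p. (\<lambda>v. torus_deriv f p *v v) ` C p \<subseteq> insert 0 (interior (C (f p))))"

definition unstable_cone_family :: "(torus \<Rightarrow> torus) \<Rightarrow> (torus \<Rightarrow> (real^2) set) \<Rightarrow> bool" where
  "unstable_cone_family f C \<longleftrightarrow> invariant_cone_family f C \<and>
     (\<exists>k>0. \<forall>p. \<forall>v\<in>C p. norm v = 1 \<longrightarrow> norm (torus_deriv (f ^^ k) p *v v) > 1)"

definition partially_hyperbolic :: "(torus \<Rightarrow> torus) \<Rightarrow> bool" where
  "partially_hyperbolic f \<longleftrightarrow> torus_local_diffeo f \<and> (\<exists>C. unstable_cone_family f C)"

definition continuous_line_field :: "(torus \<Rightarrow> (real^2) set) \<Rightarrow> bool" where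
  "continuous_line_field E \<longleftrightarrow>
     (\<forall>p. \<exists>U X. open U \<and> p \<in> U \<and> continuous_on U X \<and>
        (\<forall>q\<in>U. X q \<noteq> 0 \<and> E q = span {X q}))"

text \<open>
  For a partially hyperbolic \<open>f\<close> there is exactly one such \<open>E\<close>, whichever unstable cone
  family is used.
\<close>

definition centre_direction :: "(torus \<Rightarrow> torus) \<Rightarrow> (torus \<Rightarrow> (real^2) set) \<Rightarrow> bool" where
  "centre_direction f E \<longleftrightarrow> continuous_line_field E \<and>
     (\<forall>p. (\<lambda>v. torus_deriv f p *v v) ` E p = E (f p)) \<and>
     (\<exists>C. unstable_cone_family f C \<and> (\<forall>p. E p \<inter> C p = {0}))"

section \<open>Unique integrability\<close>

definition tangent_curve ::
    "(torus \<Rightarrow> (real^2) set) \<Rightarrow> torus \<Rightarrow> real set \<Rightarrow> (real \<Rightarrow> torus) \<Rightarrow> bool" where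
  "tangent_curve E p I \<gamma> \<longleftrightarrow> open I \<and> is_interval I \<and> 0 \<in> I \<and> \<gamma> 0 = p \<and>
     (\<exists>\<gamma>'. continuous_on I \<gamma>' \<and>
        (\<forall>t\<in>I. curve_has_velocity \<gamma> (\<gamma>' t) t \<and> \<gamma>' t \<noteq> 0 \<and> \<gamma>' t \<in> E (\<gamma> t)))"

text \<open>
  The function \<open>h\<close> is the reparametrisation: a \<open>C\<^sup>1\<close> diffeomorphism onto its image, which
  may reverse the orientation.
\<close>

definition coincide_near_0 ::
    "real set \<Rightarrow> (real \<Rightarrow> torus) \<Rightarrow> real set \<Rightarrow> (real \<Rightarrow> torus) \<Rightarrow> bool" where
  "coincide_near_0 I \<gamma> J \<eta> \<longleftrightarrow>
     (\<exists>\<delta>>0. \<exists>h h'. h 0 = 0 \<and> continuous_on {-\<delta><..<\<delta>} h' \<and>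
        (\<forall>t\<in>{-\<delta><..<\<delta>}. (h has_real_derivative h' t) (at t) \<and> h' t \<noteq> 0 \<and>
            t \<in> I \<and> h t \<in> J \<and> \<gamma> t = \<eta> (h t)))"

definition uniquely_integrable_at :: "(torus \<Rightarrow> (real^2) set) \<Rightarrow> torus \<Rightarrow> bool" where
  "uniquely_integrable_at E p \<longleftrightarrow>
     (\<exists>I \<gamma>. tangent_curve E p I \<gamma>) \<and>
     (\<forall>I \<gamma> J \<eta>. tangent_curve E p I \<gamma> \<and> tangent_curve E p J \<eta> \<longrightarrow> coincide_near_0 I \<gamma> J \<eta>)"

definition uniquely_integrable_on :: "(torus \<Rightarrow> (real^2) set) \<Rightarrow> torus set \<Rightarrow> bool" where
  "uniquely_integrable_on E S \<longleftrightarrow> (\<forall>p\<in>S. uniquely_integrable_at E p)"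

abbreviation uniquely_integrable :: "(torus \<Rightarrow> (real^2) set) \<Rightarrow> bool" where
  "uniquely_integrable E \<equiv> uniquely_integrable_on E UNIV"

text \<open>\<open>C\<^sup>1\<close> embedded circles, parametrised injectively by \<open>\<real>/\<int>\<close>.\<close>

definition circle_in_torus :: "torus set \<Rightarrow> bool" where
  "circle_in_torus S \<longleftrightarrow>
     (\<exists>\<gamma> \<gamma>'. continuous_on UNIV \<gamma>' \<and>
        (\<forall>t. curve_has_velocity \<gamma> (\<gamma>' t) t \<and> \<gamma>' t \<noteq> 0) \<and>
        (\<forall>s t. \<gamma> s = \<gamma> t \<longleftrightarrow> s - t \<in> \<int>) \<and> S = range \<gamma>)"

end

theory Submission
  imports Defs
begin

text \<open>
  The example is the skew product \<open>f (x, y) = (g x, x + 2 y)\<close>, where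
  \<open>g x = 2 x - 9 / (10 \<pi>) sin (2 \<pi> x)\<close> is a circle map of degree two for which \<open>0\<close> is an
  attracting fixed point.  Damping the sine term to zero is a homotopy from \<open>f\<close> to the linear map
  with rows \<open>(2, 0)\<close> and \<open>(1, 2)\<close>, whose only eigenvalue is \<open>2\<close>.

  The derivative of \<open>f\<close> maps the slope field \<open>dy/dx = - b x\<close> to itself exactly when
  \<open>2 b x = 1 + g' x * b (g x)\<close>, which is solved by \<open>b = (\<Sum>n. (g\<^sup>n)' / 2\<^sup>n\<^sup>+\<^sup>1)\<close>.  All terms
  are positive, so \<open>b\<close> makes sense everywhere if the value \<open>\<infinity>\<close> is admitted, and
  \<open>w = 1 / b\<close> is a real function.  On the basin of attraction of \<open>0\<close> the series converges
  geometrically, so \<open>b\<close> is finite and continuous.  Off the basin, \<open>g' > 2\<close> along the whole orbit,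
  hence \<open>b = \<infinity>\<close> and \<open>w = 0\<close>; lower semicontinuity of a sum of positive continuous functions makes
  \<open>w\<close> continuous there too (\<open>isCont_tilt\<close>).  So the span of \<open>(w x, -1)\<close> is a continuous invariant
  line field, vertical exactly off the basin.  This is the centre direction.

  Partial hyperbolicity: the functional \<open>\<tau> v = v\<^sub>1 + w v\<^sub>2\<close> annihilates the centre direction and is
  multiplied by \<open>m = g' + w \<circ> g\<close>, while the centre vector is multiplied by \<open>c = 2 - w\<close>.  Since
  \<open>m c = 2 g'\<close>, everything follows from \<open>c \<le> g'\<close> (\<open>tilt_ge\<close>): it gives \<open>m \<ge> 2\<close>, and then \<open>m > c\<close>.
  The cone \<open>\<bar>v\<^sub>2\<bar> \<le> R \<bar>\<tau> v\<bar>\<close> is therefore invariant and expanded, for \<open>R\<close> large.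

  Over the basin, which is open and dense, \<open>y + \<integral> b\<close> is constant along every tangent curve, and \<open>x\<close>
  is strictly monotone along it.  This determines the curve without any Lipschitz bound on the
  direction field (\<open>uniquely_integrable_basin\<close>).

  At the repelling fixed point \<open>a\<close> that bounds the component of the basin around \<open>0\<close>, the vertical
  circle \<open>x = a\<close> is tangent to the centre direction.  The graphs \<open>y = const - B x\<close> with
  \<open>B = (\<Sum>n. g\<^sup>n / 2\<^sup>n\<^sup>+\<^sup>1)\<close>, a primitive of \<open>b\<close>, are tangent to it as well.  On \<open>[0, a]\<close> the iterates
  of \<open>g\<close> are bounded, so \<open>B\<close> is continuous up to \<open>a\<close> although its derivative blows up: these curves
  reach the circle at finite height, vertically, and may then continue along it.  Hence every
  point of the circle has two tangent curves (\<open>not_uniquely_integrable_branch\<close>).  The property is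
  inherited by preimages, and the backward orbit of \<open>a + 1\<close> under the lift of \<open>g\<close> decreases to \<open>a\<close>,
  which yields infinitely many such circles (\<open>branch_points\<close>).
\<close>

section \<open>A circle map of degree two with an attracting fixed point\<close>

text \<open>
  The amplitude lies in the window in which everything works: the coefficient \<open>9/5\<close> of the cosine in
  the derivative is below \<open>2\<close>, so the map is increasing, and above \<open>\<pi>/2\<close>, so \<open>1/4\<close> is
  attracted to \<open>0\<close>.  The second condition makes the map expand by more than \<open>2\<close>, the rate in the
  vertical direction, wherever an orbit escapes the attraction of \<open>0\<close>.
\<close>

definition base_map :: "real \<Rightarrow> real" where
  "base_map x = 2 * x - 9 / (10 * pi) * sin (2 * pi * x)"

definition slope :: "real \<Rightarrow> real" where
  "slope x = 2 - 9/5 * cos (2 * pi * x)"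

lemma isCont_iff_tendsto_nhds: "isCont f x \<longleftrightarrow> (f \<longlongrightarrow> f x) (nhds x)"
  using tendsto_at_iff_tendsto_nhds[of f x] by (simp add: isCont_def)

lemma base_map_deriv: "(base_map has_real_derivative slope x) (at x)"
  unfolding base_map_def[abs_def] slope_def
  by (rule derivative_eq_intros refl | simp)+

lemma slope_ge: "slope x \<ge> 1/5"
  using cos_le_one[of "2 * pi * x"] unfolding slope_def by linarith

lemma slope_pos: "slope x > 0"
  using slope_ge[of x] by linarith

lemma continuous_slope: "continuous_on S slope"
  unfolding slope_def[abs_def] by (intro continuous_intros)

lemma isCont_slope: "isCont slope x"
  using continuous_slope[of UNIV] by (simp add: continuous_on_eq_continuous_at)

lemma isCont_base_map: "isCont base_map x"
  using base_map_deriv DERIV_isCont by blast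

lemma continuous_base_map: "continuous_on S base_map"
  using isCont_base_map continuous_at_imp_continuous_on by blast

lemma sin_periodic_int: "sin (2 * pi * (x + of_int k)) = sin (2 * pi * x)"
  using sin_integer_2pi[of "of_int k"] cos_integer_2pi[of "of_int k"]
  by (simp add: distrib_left sin_add)

lemma cos_periodic_int: "cos (2 * pi * (x + of_int k)) = cos (2 * pi * x)"
  using sin_integer_2pi[of "of_int k"] cos_integer_2pi[of "of_int k"]
  by (simp add: distrib_left cos_add)

lemma base_map_add_int: "base_map (x + of_int k) = base_map x + of_int (2 * k)"
  using sin_periodic_int[of x k] by (simp add: base_map_def)

lemma slope_add_int: "slope (x + of_int k) = slope x"
  using cos_periodic_int[of x k] by (simp add: slope_def)

lemma base_map_strict_mono: "strict_mono base_map"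
proof (rule strict_monoI)
  fix x y :: real
  assume "x < y"
  then show "base_map x < base_map y"
    by (rule DERIV_pos_imp_increasing) (blast intro: base_map_deriv slope_pos)
qed

lemma base_map_less_iff [simp]: "base_map x < base_map y \<longleftrightarrow> x < y"
  using base_map_strict_mono by (simp add: strict_mono_less)

lemma base_map_le_iff [simp]: "base_map x \<le> base_map y \<longleftrightarrow> x \<le> y"
  using base_map_strict_mono by (simp add: strict_mono_less_eq)

lemma base_map_inj: "inj base_map"
  using base_map_strict_mono strict_mono_imp_inj_on by blast

lemma base_map_0 [simp]: "base_map 0 = 0"
  by (simp add: base_map_def)

lemma base_map_near_double: "\<bar>base_map x - 2 * x\<bar> \<le> 1"
proof -
  have "0 \<le> 9 / (10 * pi)" by simp
  moreover have "9 / (10 * pi) \<le> 1"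
    using pi_gt3 by (simp add: divide_le_eq)
  ultimately have "\<bar>9 / (10 * pi)\<bar> * \<bar>sin (2 * pi * x)\<bar> \<le> 1 * 1"
    by (intro mult_mono) (simp_all del: abs_divide)
  then have "\<bar>9 / (10 * pi) * sin (2 * pi * x)\<bar> \<le> 1"
    by (simp only: abs_mult mult_1)
  moreover have "base_map x - 2 * x = - (9 / (10 * pi) * sin (2 * pi * x))"
    unfolding base_map_def by linarith
  ultimately show ?thesis by (simp only: abs_minus_cancel)
qed

lemma base_map_surj: "surj base_map"
proof -
  have "\<exists>x. base_map x = y" for y
  proof -
    let ?l = "(y - 1) / 2" and ?u = "(y + 1) / 2"
    have "base_map ?l \<le> y" "y \<le> base_map ?u"
      using base_map_near_double[of ?l] base_map_near_double[of ?u]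
      unfolding abs_le_iff by (simp_all add: field_simps)
    then have "\<exists>x\<ge>?l. x \<le> ?u \<and> base_map x = y"
      by (intro IVT' continuous_base_map) simp_all
    then show ?thesis by blast
  qed
  then show ?thesis by (metis surjI)
qed

text \<open>
  This is the condition \<open>9/5 > \<pi>/2\<close>: the points where the slope passes through \<open>2\<close> are attracted
  to \<open>0\<close>.
\<close>

lemma base_map_quarter: "base_map (1/4) < 1/4"
proof -
  have "2 * pi * (1/4) = pi / 2" by simp
  then have "base_map (1/4) = 1/2 - 9 / (10 * pi)"
    unfolding base_map_def by simp
  moreover have "pi < 18/5" using pi_approx by simp
  then have "9 / (10 * pi) > 1/4"
    by (simp add: less_divide_eq)
  ultimately show ?thesis by linarith
qed

lemma base_map_convex: "convex_on {0..1/4} base_map"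
proof (rule f''_ge0_imp_convex)
  show "convex {0..1/4::real}" by simp
  show "(base_map has_real_derivative slope x) (at x)" for x by (rule base_map_deriv)
  show "(slope has_real_derivative 9/5 * (2 * pi * sin (2 * pi * x))) (at x)" for x
    unfolding slope_def[abs_def] by (rule derivative_eq_intros refl | simp)+
  show "0 \<le> 9/5 * (2 * pi * sin (2 * pi * x))" if "x \<in> {0..1/4}" for x
  proof -
    have "2 * pi * x \<le> 2 * pi * (1/4)" using that by (intro mult_left_mono) auto
    then have "2 * pi * x \<le> pi" using pi_gt_zero by linarith
    then show ?thesis using that by (simp add: sin_ge_zero)
  qed
qed

text \<open>
  By convexity the graph lies below the chord from \<open>0\<close> to \<open>1/4\<close>, whose slope is less than \<open>1\<close>.
\<close>

lemma base_map_contracts_quarter: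
  assumes "0 \<le> x" "x \<le> 1/4"
  shows "0 \<le> base_map x" "base_map x \<le> x"
proof -
  show "0 \<le> base_map x" using base_map_le_iff[of 0 x] assms by simp
  have "base_map ((1 - 4*x) *\<^sub>R 0 + (4*x) *\<^sub>R (1/4)) \<le> (1 - 4*x) * base_map 0 + (4*x) * base_map (1/4)"
    by (rule convex_onD[OF base_map_convex]) (use assms in auto)
  also have "\<dots> \<le> (4*x) * (1/4)"
    using mult_left_mono[OF less_imp_le[OF base_map_quarter], of "4 * x"] assms by simp
  finally show "base_map x \<le> x" by simp
qed

lemma base_map_odd: "base_map (- x) = - base_map x"
  by (simp add: base_map_def)

lemma nonneg_cos_representative:
  assumes "cos (2 * pi * x) \<ge> 0"
  obtains k r where "x = r + of_int k" "\<bar>r\<bar> \<le> 1/4"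
proof -
  define k where "k = \<lfloor>x + 1/2\<rfloor>"
  define r where "r = x - of_int k"
  have r: "-1/2 \<le> r" "r < 1/2" unfolding r_def k_def by linarith+
  have "cos (2 * pi * r) \<ge> 0"
    using assms cos_periodic_int[of r k] by (simp add: r_def)
  moreover have "cos (2 * pi * \<bar>r\<bar>) = cos (2 * pi * r)"
    by (simp add: abs_if)
  ultimately have c: "cos (2 * pi * \<bar>r\<bar>) \<ge> 0" by simp
  have "\<bar>r\<bar> \<le> 1/4"
  proof (rule ccontr)
    assume "\<not> \<bar>r\<bar> \<le> 1/4"
    then have "\<bar>r\<bar> > 1/4" by simp
    then have "pi/2 < 2 * pi * \<bar>r\<bar>" by (simp add: field_simps)
    moreover have "\<bar>r\<bar> \<le> 1/2" using r unfolding abs_le_iff by linarith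
    then have "2 * pi * \<bar>r\<bar> \<le> pi" by (simp add: field_simps)
    ultimately have "cos (2 * pi * \<bar>r\<bar>) < cos (pi/2)"
      by (intro cos_monotone_0_pi) auto
    with c show False by simp
  qed
  then show ?thesis using that[of r k] by (simp add: r_def)
qed

lemma cos_mono_in_abs:
  assumes "\<bar>s\<bar> \<le> \<bar>r\<bar>" "\<bar>r\<bar> \<le> 1/4"
  shows "cos (2 * pi * r) \<le> cos (2 * pi * s)"
proof -
  have "cos (2 * pi * \<bar>r\<bar>) \<le> cos (2 * pi * \<bar>s\<bar>)"
  proof (rule cos_monotone_0_pi_le)
    show "2 * pi * \<bar>s\<bar> \<le> 2 * pi * \<bar>r\<bar>" using assms by (intro mult_left_mono) auto
    have "2 * pi * \<bar>r\<bar> \<le> 2 * pi * (1/4)" using assms by (intro mult_left_mono) auto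
    then show "2 * pi * \<bar>r\<bar> \<le> pi" using pi_gt_zero by linarith
  qed auto
  then show ?thesis by (simp add: abs_if split: if_splits)
qed

text \<open>
  The function \<open>cos (2 * pi * x)\<close> measures the distance from the nearest integer, and near the
  integers the map brings points closer.  As \<open>slope\<close> decreases with this cosine, slopes
  do not increase along orbits that are already near the attracting point.
\<close>

lemma cos_increases_along_orbit:
  assumes "cos (2 * pi * x) \<ge> 0"
  shows "cos (2 * pi * x) \<le> cos (2 * pi * base_map x)"
proof -
  obtain k r where x: "x = r + of_int k" and r: "\<bar>r\<bar> \<le> 1/4"
    using nonneg_cos_representative[OF assms] .
  have "\<bar>base_map r\<bar> \<le> \<bar>r\<bar>"
  proof (cases "r \<ge> 0")
    case True
    then show ?thesis using base_map_contracts_quarter[of r] r by simp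
  next
    case False
    then show ?thesis using base_map_contracts_quarter[of "-r"] r by (simp add: base_map_odd)
  qed
  then have "cos (2 * pi * r) \<le> cos (2 * pi * base_map r)"
    using r by (rule cos_mono_in_abs)
  then show ?thesis
    unfolding x base_map_add_int cos_periodic_int .
qed

section \<open>The basin of attraction\<close>

text \<open>
  Points with positive cosine are at distance less than \<open>1/4\<close> from an integer, and by
  \<open>cos_increases_along_orbit\<close> their orbits never leave that region.
\<close>

definition basin :: "real set" where
  "basin = {x. \<exists>n. cos (2 * pi * (base_map ^^ n) x) > 0}"

lemma basin_pos_cosI: "cos (2 * pi * x) > 0 \<Longrightarrow> x \<in> basin"
  unfolding basin_def by (auto intro: exI[of _ 0])

lemma basin_stepD: "base_map x \<in> basin \<Longrightarrow> x \<in> basin"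
  unfolding basin_def mem_Collect_eq by (metis comp_apply funpow_Suc_right)

lemma basin_stepI:
  assumes "x \<in> basin" shows "base_map x \<in> basin"
proof -
  from assms obtain n where n: "cos (2 * pi * (base_map ^^ n) x) > 0"
    by (auto simp: basin_def)
  show ?thesis
  proof (cases n)
    case 0
    with n have "cos (2 * pi * base_map x) > 0"
      using cos_increases_along_orbit[of x] by simp
    then show ?thesis by (rule basin_pos_cosI)
  next
    case (Suc m)
    with n show ?thesis unfolding basin_def by (auto simp: funpow_Suc_right simp del: funpow.simps)
  qed
qed

lemma basin_step [simp]: "base_map x \<in> basin \<longleftrightarrow> x \<in> basin"
  using basin_stepD basin_stepI by blast

text \<open>
  Invariance equations let local properties at \<open>base_map x\<close> be pulled back to \<open>x\<close>, so it is
  enough to prove them near the attracting point.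
\<close>

lemma basin_induct [consumes 1, case_names core step]:
  assumes "x \<in> basin"
    and core: "\<And>x. cos (2 * pi * x) > 0 \<Longrightarrow> P x"
    and step: "\<And>x. base_map x \<in> basin \<Longrightarrow> P (base_map x) \<Longrightarrow> P x"
  shows "P x"
proof -
  from assms(1) obtain n where "cos (2 * pi * (base_map ^^ n) x) > 0"
    by (auto simp: basin_def)
  then show ?thesis
  proof (induction n arbitrary: x)
    case 0
    then show ?case by (simp add: core)
  next
    case (Suc n)
    then have *: "cos (2 * pi * (base_map ^^ n) (base_map x)) > 0"
      by (simp add: funpow_Suc_right del: funpow.simps)
    then have "base_map x \<in> basin" by (auto simp: basin_def)
    then show ?case using Suc.IH[OF *] step by blast
  qed
qed

lemma basin_add_int: "x + of_int k \<in> basin \<longleftrightarrow> x \<in> basin"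
proof -
  have imp: "x + of_int k \<in> basin" if "x \<in> basin" for x and k :: int
    using that
  proof (induction x arbitrary: k rule: basin_induct)
    case (core x)
    then show ?case by (intro basin_pos_cosI) (simp only: cos_periodic_int)
  next
    case (step x)
    then have "base_map x + of_int (2 * k) \<in> basin" by blast
    then show ?case using basin_stepD[of "x + of_int k"] by (simp only: base_map_add_int)
  qed
  from imp[of x k] imp[of "x + of_int k" "-k"] show ?thesis by auto
qed

lemma continuous_funpow_base_map: "continuous_on UNIV (base_map ^^ n)"
proof (induction n)
  case (Suc n)
  show ?case unfolding funpow.simps
    by (intro continuous_on_compose Suc continuous_base_map)
qed (simp add: continuous_on_id id_def)

lemma open_basin: "open basin"
proof -
  have "basin = (\<Union>n. {x. cos (2 * pi * (base_map ^^ n) x) > 0})"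
    by (auto simp: basin_def)
  moreover have "open {x. cos (2 * pi * (base_map ^^ n) x) > 0}" for n
    by (intro open_Collect_less continuous_intros continuous_funpow_base_map)
  ultimately show ?thesis by (metis open_UN)
qed

text \<open>
  The inequality is strict because the points where the slope equals \<open>2\<close> lie in the basin, by
  \<open>base_map_quarter\<close>.
\<close>

lemma slope_gt_2_outside_basin:
  assumes "x \<notin> basin"
  shows "slope x > 2"
proof -
  have le: "cos (2 * pi * x) \<le> 0" using assms basin_pos_cosI[of x] by force
  have "cos (2 * pi * x) \<noteq> 0"
  proof
    assume 0: "cos (2 * pi * x) = 0"
    obtain k r where x: "x = r + of_int k" and r: "\<bar>r\<bar> \<le> 1/4"
      using nonneg_cos_representative[OF eq_refl[OF 0[symmetric]]] .
    have less: "\<bar>base_map r\<bar> < 1/4"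
    proof -
      have "r \<le> 1/4" "- r \<le> 1/4" using r by auto
      then have "base_map r \<le> base_map (1/4)" "base_map (- r) \<le> base_map (1/4)"
        by (simp_all only: base_map_le_iff)
      then show ?thesis using base_map_quarter unfolding base_map_odd by linarith
    qed
    have "cos (2 * pi * base_map r) > 0"
    proof (rule cos_gt_zero_pi)
      have "2 * pi * base_map r < 2 * pi * (1/4)" "2 * pi * - base_map r < 2 * pi * (1/4)"
        using less by (intro mult_strict_left_mono; simp add: abs_less_iff)+
      then show "- (pi/2) < 2 * pi * base_map r" "2 * pi * base_map r < pi/2" by simp_all
    qed
    then have "base_map r \<in> basin" by (rule basin_pos_cosI)
    then show False using assms unfolding x basin_add_int by simp
  qed
  with le show ?thesis by (simp add: slope_def)
qed

lemma base_map_doubles_distance: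
  assumes "x \<le> y" "\<And>z. z \<in> {x..y} \<Longrightarrow> slope z \<ge> 2"
  shows "base_map y - base_map x \<ge> 2 * (y - x)"
proof (cases "x = y")
  case False
  then obtain z where "z > x" "z < y" "base_map y - base_map x = (y - x) * slope z"
    using MVT2[of x y base_map slope] base_map_deriv assms(1) by auto
  then show ?thesis
    using assms mult_left_mono[of 2 "slope z" "y - x"] by (simp add: mult.commute)
qed simp

text \<open>
  An interval disjoint from the basin would at least double its length under every iterate, since
  the slope exceeds \<open>2\<close> on it.  Its images are again disjoint from the basin, but
  they become longer than \<open>1\<close> and then contain an integer.
\<close>

lemma basin_dense:
  assumes "x < y"
  obtains z where "z \<in> basin" "x < z" "z < y"
proof -
  have False if "\<And>z. z \<in> {x..y} \<Longrightarrow> z \<notin> basin" "x < y" for x y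
  proof -
    have *: "\<exists>x' y'. (\<forall>z\<in>{x'..y'}. z \<notin> basin) \<and> y' - x' \<ge> 2 ^ n * (y - x)" for n
    proof (induction n)
      case 0
      then show ?case using that by (intro exI[of _ x] exI[of _ y]) auto
    next
      case (Suc n)
      then obtain x' y' where xy: "\<forall>z\<in>{x'..y'}. z \<notin> basin" "y' - x' \<ge> 2 ^ n * (y - x)"
        by blast
      have "0 < 2 ^ n * (y - x)" using that by simp
      with xy have "x' \<le> y'" by linarith
      have "\<forall>z\<in>{base_map x'..base_map y'}. z \<notin> basin"
      proof
        fix z assume z: "z \<in> {base_map x'..base_map y'}"
        obtain t where "z = base_map t" using base_map_surj by blast
        then show "z \<notin> basin" using z xy by auto
      qed
      moreover have "base_map y' - base_map x' \<ge> 2 * (y' - x')"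
        using xy \<open>x' \<le> y'\<close>
        by (intro base_map_doubles_distance less_imp_le[OF slope_gt_2_outside_basin]) blast+
      then have "base_map y' - base_map x' \<ge> 2 ^ Suc n * (y - x)" using xy by simp
      ultimately show ?case by blast
    qed
    obtain n where "1 / (y - x) < 2 ^ n" using real_arch_pow[of 2 "1 / (y - x)"] by auto
    then have "1 < 2 ^ n * (y - x)" using that by (simp add: field_simps)
    with *[of n] obtain x' y' where xy: "\<forall>z\<in>{x'..y'}. z \<notin> basin" "y' - x' > 1" by force
    have "of_int \<lceil>x'\<rceil> \<in> {x'..y'}" using xy by (simp, linarith)
    moreover have "of_int \<lceil>x'\<rceil> \<in> basin"
      using basin_add_int[of 0 "\<lceil>x'\<rceil>"] basin_pos_cosI[of 0] by simp
    ultimately show False using xy by blast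
  qed
  \<comment> \<open>The contradiction concerns closed intervals; the middle third lies inside the open one.\<close>
  from this[of "(2*x+y)/3" "(x+2*y)/3"] assms obtain z
    where "z \<in> basin" "z \<in> {(2*x+y)/3..(x+2*y)/3}" by auto
  with assms show ?thesis by (intro that[of z]) auto
qed

section \<open>Slope of the centre direction\<close>

text \<open>
  By the chain rule \<open>weight n\<close> is the derivative of the \<open>n\<close>-th iterate divided by \<open>2 ^ Suc n\<close>; the
  recursion is arranged so that the invariance equation is read off by splitting the first term of
  the series.
\<close>

fun weight :: "nat \<Rightarrow> real \<Rightarrow> real" where
  "weight 0 x = 1/2"
| "weight (Suc n) x = slope x / 2 * weight n (base_map x)"

definition steepness :: "real \<Rightarrow> real" where
  "steepness x = (\<Sum>n. weight n x)"

text \<open>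
  Outside the basin the series of \<open>steepness\<close> diverges, and the default value of \<open>suminf\<close> says
  nothing; there \<open>tilt\<close> is the reciprocal of the true sum \<open>\<infinity>\<close>.
\<close>

definition tilt :: "real \<Rightarrow> real" where
  "tilt x = (if x \<in> basin then 1 / steepness x else 0)"

lemma weight_pos: "weight n x > 0"
  by (induction n arbitrary: x) (auto simp: slope_pos)

lemma isCont_weight: "isCont (weight n) x"
proof (induction n arbitrary: x)
  case 0
  have "weight 0 = (\<lambda>_. 1/2)" by auto
  then show ?case by simp
next
  case (Suc n)
  have *: "weight (Suc n) = (\<lambda>x. slope x / 2 * weight n (base_map x))" by auto
  show ?case unfolding *
    by (intro continuous_intros isCont_slope isCont_o2[OF isCont_base_map Suc]) auto
qed

text \<open>
  Slopes do not increase along the orbit, so every factor is at most \<open>slope x / 2\<close>, which the cosine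
  keeps below \<open>1\<close>.
\<close>

lemma weight_le_core:
  assumes "0 \<le> e" "e \<le> cos (2 * pi * x)"
  shows "weight n x \<le> 1/2 * (1 - 9/10 * e) ^ n"
  using assms
proof (induction n arbitrary: x)
  case (Suc n)
  have "e \<le> cos (2 * pi * base_map x)"
    using cos_increases_along_orbit[of x] Suc.prems by linarith
  then have IH: "weight n (base_map x) \<le> 1/2 * (1 - 9/10 * e) ^ n"
    using Suc by blast
  have "slope x / 2 \<le> 1 - 9/10 * e" using Suc.prems by (simp add: slope_def)
  moreover have "e \<le> 1" using Suc.prems cos_le_one[of "2 * pi * x"] by linarith
  ultimately have "slope x / 2 * weight n (base_map x) \<le> (1 - 9/10 * e) * (1/2 * (1 - 9/10 * e) ^ n)"
    using IH weight_pos[of n "base_map x"] by (intro mult_mono) auto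
  then show ?case by simp
qed simp

lemma geometric_ratio_bounds:
  assumes "0 < e" "e \<le> cos (2 * pi * x)"
  shows "0 \<le> 1 - 9/10 * e" "1 - 9/10 * e < 1"
  using assms cos_le_one[of "2 * pi * x"] by linarith+

lemma summable_weight_core:
  assumes "cos (2 * pi * x) > 0"
  shows "summable (\<lambda>n. weight n x)"
proof (rule summable_comparison_test)
  let ?e = "cos (2 * pi * x)"
  show "\<exists>N. \<forall>n\<ge>N. norm (weight n x) \<le> 1/2 * (1 - 9/10 * ?e) ^ n"
    using weight_le_core[of ?e x] assms weight_pos[of _ x] by (auto simp: abs_of_pos)
  show "summable (\<lambda>n. 1/2 * (1 - 9/10 * ?e) ^ n)"
    using geometric_ratio_bounds[of ?e x] assms by (intro summable_mult summable_geometric) auto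
qed

lemma summable_weight:
  assumes "x \<in> basin"
  shows "summable (\<lambda>n. weight n x)"
  using assms
proof (induction x rule: basin_induct)
  case (core x)
  then show ?case by (rule summable_weight_core)
next
  case (step x)
  have "summable (\<lambda>n. weight (Suc n) x)"
    using step by (simp add: summable_mult)
  then show ?case by (subst (asm) summable_Suc_iff)
qed

lemma steepness_step:
  assumes "x \<in> basin"
  shows "steepness x = 1/2 + slope x / 2 * steepness (base_map x)"
proof -
  have "steepness x = weight 0 x + (\<Sum>n. weight (Suc n) x)"
    unfolding steepness_def using suminf_split_head[OF summable_weight[OF assms]] by simp
  also have "(\<Sum>n. weight (Suc n) x) = slope x / 2 * steepness (base_map x)"
    unfolding steepness_def using suminf_mult[OF summable_weight, of "base_map x" "slope x / 2"] assms by simp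
  finally show ?thesis by simp
qed

lemma steepness_ge: 
  assumes "x \<in> basin"
  shows "steepness x \<ge> 1/2"
  using sum_le_suminf[OF summable_weight[OF assms], of "{0}"] weight_pos[THEN less_imp_le] 
  by (simp add: steepness_def)

lemma tilt_pos: "x \<in> basin \<Longrightarrow> tilt x > 0"
  using steepness_ge[of x] by (simp add: tilt_def)

lemma tilt_outside: "x \<notin> basin \<Longrightarrow> tilt x = 0"
  by (simp add: tilt_def)

lemma tilt_nonneg: "tilt x \<ge> 0"
  using tilt_pos[of x] tilt_outside[of x] by force

text \<open>
  Invariance of the centre direction, expressed without reference to the infinite values of the
  steepness.
\<close>

lemma tilt_step: "tilt x * (tilt (base_map x) + slope x) = 2 * tilt (base_map x)"
proof (cases "x \<in> basin")
  case True
  then have "steepness x > 0" "steepness (base_map x) > 0"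
    using steepness_ge[of x] steepness_ge[of "base_map x"] by auto
  then have "1 / steepness x * (1 / steepness (base_map x) + slope x) = 2 * (1 / steepness (base_map x))"
    using steepness_step[OF True] by (simp add: divide_simps distrib_left)
  with True show ?thesis by (simp add: tilt_def)
qed (simp add: tilt_outside)

lemma weight_add_int: "weight n (x + of_int k) = weight n x"
  by (induction n arbitrary: x k) (auto simp only: weight.simps slope_add_int base_map_add_int)

lemma tilt_add_int: "tilt (x + of_int k) = tilt x"
  by (simp add: tilt_def basin_add_int steepness_def weight_add_int)

lemma uniform_limit_weight:
  assumes "0 < e" "S \<subseteq> {x. e \<le> cos (2 * pi * x)}"
  shows "uniform_limit S (\<lambda>n z. \<Sum>i<n. weight i z) steepness sequentially"
proof (cases "S = {}")
  case False
  then obtain x where "e \<le> cos (2 * pi * x)" using assms by auto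
  note r = geometric_ratio_bounds[OF assms(1) this]
  show ?thesis unfolding steepness_def[abs_def]
  proof (rule Weierstrass_m_test)
    show "norm (weight n z) \<le> 1/2 * (1 - 9/10 * e) ^ n" if "z \<in> S" for n z
      using that weight_le_core[of e z n] weight_pos[of n z] assms by (auto simp: abs_of_pos)
    show "summable (\<lambda>n. 1/2 * (1 - 9/10 * e) ^ n)"
      using r by (intro summable_mult summable_geometric) auto
  qed
qed simp

lemma isCont_steepness:
  assumes "x \<in> basin"
  shows "isCont steepness x"
  using assms
proof (induction x rule: basin_induct)
  case (core x)
  define e where "e = cos (2 * pi * x) / 2"
  define S where "S = {z. cos (2 * pi * z) > e}"
  have S: "open S" "x \<in> S" "e > 0"
    unfolding S_def e_def using core by (auto intro!: open_Collect_less continuous_intros)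
  have "uniform_limit S (\<lambda>n z. \<Sum>i<n. weight i z) steepness sequentially"
    using S by (intro uniform_limit_weight[of e]) (auto simp: S_def)
  moreover have "\<forall>\<^sub>F n in sequentially. continuous_on S (\<lambda>z. \<Sum>i<n. weight i z)"
    by (intro always_eventually allI continuous_on_sum continuous_at_imp_continuous_on ballI isCont_weight)
  ultimately have "continuous_on S steepness"
    by (intro uniform_limit_theorem[of _ "\<lambda>n z. \<Sum>i<n. weight i z" sequentially]) auto
  then show ?case using S continuous_on_eq_continuous_at by blast
next
  case (step x)
  then have x: "x \<in> basin" by simp
  have "isCont (\<lambda>x. 1/2 + slope x / 2 * steepness (base_map x)) x"
    by (intro continuous_intros isCont_slope isCont_o2[OF isCont_base_map step.IH]) auto
  moreover have "\<forall>\<^sub>F z in nhds x. steepness z = 1/2 + slope z / 2 * steepness (base_map z)"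
    using eventually_nhds_in_open[OF open_basin x] by eventually_elim (rule steepness_step)
  ultimately show ?case using isCont_cong by fast
qed

text \<open>
  Off the basin every weight is at least \<open>1/2\<close>, so some partial sum is as large as desired at \<open>x\<close>,
  and by continuity on a neighbourhood.  The full sum is larger still, so \<open>tilt\<close> is small
  near \<open>x\<close>.
\<close>

lemma isCont_tilt: "isCont tilt x"
proof (cases "x \<in> basin")
  case True
  have "\<forall>\<^sub>F z in nhds x. tilt z = 1 / steepness z"
    using eventually_nhds_in_open[OF open_basin True] by eventually_elim (simp add: tilt_def)
  moreover have "isCont (\<lambda>z. 1 / steepness z) x"
    using steepness_ge[OF True] by (intro continuous_intros isCont_steepness True) auto
  ultimately show ?thesis using isCont_cong by fast
next
  case False
  have "weight n x \<ge> 1/2" for n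
    using False
  proof (induction n arbitrary: x)
    case (Suc n)
    have "1 * (1/2) \<le> slope x / 2 * weight n (base_map x)"
      using slope_gt_2_outside_basin[OF Suc.prems] Suc.IH[of "base_map x"] Suc.prems
      by (intro mult_mono) auto
    then show ?case by simp
  qed simp
  then have big: "(\<Sum>i<n. weight i x) \<ge> real n / 2" for n
    using sum_bounded_below[of "{..<n}" "1/2" "\<lambda>i. weight i x"] by simp
  have "(tilt \<longlongrightarrow> 0) (nhds x)"
  proof (rule tendstoI)
    fix e :: real assume e: "e > 0"
    obtain n where n: "real n > 2 / e" using reals_Archimedean2 by blast
    have "(\<Sum>i<n. weight i x) > 1 / e" using n big[of n] by linarith
    moreover have "isCont (\<lambda>z. \<Sum>i<n. weight i z) x"
      by (intro continuous_intros isCont_weight)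
    then have "((\<lambda>z. \<Sum>i<n. weight i z) \<longlongrightarrow> (\<Sum>i<n. weight i x)) (nhds x)"
      unfolding isCont_iff_tendsto_nhds .
    ultimately have "\<forall>\<^sub>F z in nhds x. (\<Sum>i<n. weight i z) > 1 / e"
      by (rule order_tendstoD(1)[rotated])
    then show "\<forall>\<^sub>F z in nhds x. dist (tilt z) 0 < e"
    proof eventually_elim
      case (elim z)
      show ?case
      proof (cases "z \<in> basin")
        case True
        have "(\<Sum>i<n. weight i z) \<le> steepness z"
          unfolding steepness_def using weight_pos[THEN less_imp_le]
          by (intro sum_le_suminf summable_weight True) auto
        with elim have "1 / e < steepness z" by linarith
        moreover have "steepness z > 0" using steepness_ge[OF True] by linarith
        ultimately show ?thesis using True e by (simp add: tilt_def field_simps)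
      qed (simp add: tilt_outside e)
    qed
  qed
  then show ?thesis by (simp add: isCont_iff_tendsto_nhds tilt_outside[OF False])
qed

lemma continuous_tilt: "continuous_on S tilt"
  using isCont_tilt continuous_at_imp_continuous_on by blast

text \<open>
  Where the cosine is positive the steepness is at most the geometric series of ratio
  \<open>slope x / 2\<close>, with sum \<open>1 / (2 - slope x)\<close>.  Elsewhere the lower bound is not positive.
\<close>

lemma tilt_ge: "tilt x \<ge> 2 - slope x"
proof (cases "cos (2 * pi * x) > 0")
  case True
  let ?e = "cos (2 * pi * x)"
  have e: "0 < ?e" "?e \<le> 1" using True by auto
  have "steepness x \<le> (\<Sum>n. 1/2 * (1 - 9/10 * ?e) ^ n)"
    unfolding steepness_def using weight_le_core[of ?e x] geometric_ratio_bounds[of ?e x] True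
    by (intro suminf_le summable_weight_core summable_mult summable_geometric) auto
  also have "\<dots> = 1/2 * (\<Sum>n. (1 - 9/10 * ?e) ^ n)"
    using geometric_ratio_bounds[of ?e x] True by (intro suminf_mult summable_geometric) auto
  also have "\<dots> = 1/2 * (1 / (1 - (1 - 9/10 * ?e)))"
    using geometric_ratio_bounds[of ?e x] True by (subst suminf_geometric) auto
  also have "\<dots> = 1 / (9/5 * ?e)" by (simp add: field_simps)
  finally have "steepness x \<le> 1 / (9/5 * ?e)" .
  moreover have "steepness x > 0" using steepness_ge[OF basin_pos_cosI[OF True]] by linarith
  ultimately have "9/5 * ?e \<le> 1 / steepness x" using e by (simp add: field_simps)
  then show ?thesis using basin_pos_cosI[OF True] by (simp add: tilt_def slope_def)
next
  case False
  then show ?thesis using tilt_nonneg[of x] by (simp add: slope_def)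
qed

section \<open>Expansion and domination\<close>

text \<open>
  The rate of expansion transverse to the centre direction; \<open>2 - tilt x\<close> is the rate along the
  centre vector \<open>(tilt x, -1)\<close>, and \<open>expansion_centre\<close> says that the product of the two is the
  Jacobian determinant.
\<close>

definition expansion :: "real \<Rightarrow> real" where
  "expansion x = slope x + tilt (base_map x)"

lemma expansion_pos: "expansion x > 0"
  unfolding expansion_def using tilt_nonneg[of "base_map x"] slope_pos[of x] by linarith

lemma expansion_centre: "expansion x * (2 - tilt x) = 2 * slope x"
  using tilt_step[of x] by (simp add: expansion_def algebra_simps)

lemma tilt_less_2: "tilt x < 2"
proof -
  have "expansion x * (2 - tilt x) > 0" using expansion_centre[of x] slope_pos[of x] by simp
  then show ?thesis using expansion_pos[of x] by (simp add: zero_less_mult_iff)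
qed

lemma expansion_ge_2: "expansion x \<ge> 2"
proof (rule ccontr)
  assume "\<not> expansion x \<ge> 2"
  then have "expansion x * (2 - tilt x) < 2 * (2 - tilt x)"
    using tilt_less_2[of x] by (intro mult_strict_right_mono) auto
  also have "\<dots> \<le> 2 * slope x" using tilt_ge[of x] by simp
  finally show False by (simp add: expansion_centre)
qed

text \<open>
  On the basin the transverse rate is at least \<open>2\<close> and the centre rate is below \<open>2\<close>.  Off the basin
  the rates are \<open>slope x > 2\<close> and exactly \<open>2\<close>.
\<close>

lemma domination_pointwise: "expansion x - (2 - tilt x) > 0"
proof (cases "x \<in> basin")
  case True
  then show ?thesis using expansion_ge_2[of x] tilt_pos[of x] by linarith
next
  case False
  then show ?thesis using slope_gt_2_outside_basin[of x] by (simp add: expansion_def tilt_outside)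
qed

lemma domination_uniform:
  obtains \<delta> where "\<delta> > 0" "\<And>x. expansion x - (2 - tilt x) \<ge> \<delta>"
proof -
  let ?D = "\<lambda>x. expansion x - (2 - tilt x)"
  have "continuous_on {0..1} ?D"
    unfolding expansion_def
    by (intro continuous_intros continuous_slope continuous_tilt
        continuous_on_compose2[OF continuous_tilt[of UNIV] continuous_base_map]) auto
  then obtain x0 where x0: "\<forall>x\<in>{0..1}. ?D x0 \<le> ?D x"
    using continuous_attains_inf[of "{0..1::real}" ?D] by fastforce
  show ?thesis
  proof (rule that)
    show "?D x0 > 0" by (rule domination_pointwise)
    fix x
    have "?D (frac x + of_int \<lfloor>x\<rfloor>) = ?D (frac x)"
      unfolding expansion_def slope_add_int base_map_add_int tilt_add_int by simp
    moreover have "frac x \<in> {0..1}" using frac_lt_1[of x] by (simp add: less_imp_le)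
    ultimately show "?D x \<ge> ?D x0" using x0 by (simp add: frac_def)
  qed
qed

section \<open>Centre curves that merge with a vertical line\<close>

lemma DERIV_local_inverse:
  fixes f g :: "real \<Rightarrow> real"
  assumes "open S" "x \<in> S" "continuous_on S f" "\<And>x. x \<in> S \<Longrightarrow> g (f x) = x"
    and "(f has_real_derivative D) (at x)" "D \<noteq> 0"
  shows "(g has_real_derivative 1 / D) (at (f x))"
  unfolding has_field_derivative_def
  by (rule has_derivative_inverse_strong[OF assms(1-4)])
    (use assms(5,6) in \<open>auto simp: has_field_derivative_def\<close>)

text \<open>
  The repelling fixed point is found on the interval where the cosine is not positive.
\<close>

lemma slope_ge_2_middle:
  assumes "1/4 \<le> x" "x \<le> 3/4"
  shows "slope x \<ge> 2"
proof -
  have "cos (2 * pi * (1/4)) \<le> cos (2 * pi * (x - 1/2))"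
    by (rule cos_mono_in_abs) (use assms in linarith, simp)
  moreover have "cos (2 * pi * (1/4)) = 0" by simp
  moreover have "cos (2 * pi * (x - 1/2)) = - cos (2 * pi * x)"
    using cos_minus_pi[of "2 * pi * x"] by (simp add: right_diff_distrib)
  ultimately show ?thesis by (simp add: slope_def)
qed

lemma repelling_fixed_point:
  obtains a where "1/4 < a" "a < 1/2" "base_map a = a"
proof -
  have half: "base_map (1/2) = 1" by (simp add: base_map_def)
  have "\<exists>x\<ge>1/4. x \<le> 1/2 \<and> base_map x - x = 0"
    by (rule IVT') (use base_map_quarter half in \<open>auto intro!: continuous_intros continuous_base_map\<close>)
  then obtain a where a: "1/4 \<le> a" "a \<le> 1/2" "base_map a = a" by auto
  have "a \<noteq> 1/4" using base_map_quarter a(3) by force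
  moreover have "a \<noteq> 1/2" using half a(3) by force
  ultimately have "1/4 < a" "a < 1/2" using a by auto
  with a show ?thesis by (intro that[of a]) auto
qed

lemma funpow_fixed_point: "base_map a = a \<Longrightarrow> (base_map ^^ n) a = a"
  by (induction n) auto

lemma fixed_point_not_in_basin:
  assumes "1/4 < a" "a < 1/2" "base_map a = a"
  shows "a \<notin> basin"
  using slope_ge_2_middle[of a] assms
  by (auto simp: basin_def funpow_fixed_point slope_def)

text \<open>
  An orbit that stays outside the basin stays in \<open>[1/4, a)\<close>, where its distance to the repelling
  fixed point doubles at every step.
\<close>

lemma below_fixed_point_in_basin:
  assumes a: "1/4 < a" "a < 1/2" "base_map a = a" and x: "0 < x" "x < a"
  shows "x \<in> basin"
proof (rule ccontr)
  assume nb: "x \<notin> basin"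
  have middle: "1/4 \<le> y" if "y \<notin> basin" "0 < y" for y
  proof (rule ccontr)
    assume "\<not> 1/4 \<le> y"
    then have "2 * pi * y < pi / 2" by simp
    then have "cos (2 * pi * y) > 0" using that by (intro cos_gt_zero) auto
    then show False using that basin_pos_cosI by blast
  qed
  have "(base_map ^^ n) x \<notin> basin \<and> 0 < (base_map ^^ n) x \<and> (base_map ^^ n) x < a
      \<and> a - (base_map ^^ n) x \<ge> 2 ^ n * (a - x)" for n
  proof (induction n)
    case 0
    then show ?case using x nb by simp
  next
    case (Suc n)
    let ?y = "(base_map ^^ n) x"
    have "1/4 \<le> ?y" using Suc middle by blast
    then have "base_map a - base_map ?y \<ge> 2 * (a - ?y)"
      using Suc a by (intro base_map_doubles_distance slope_ge_2_middle) auto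
    moreover have "0 < base_map ?y" using Suc base_map_less_iff[of 0 ?y] by simp
    moreover have "base_map ?y < a" using Suc base_map_less_iff[of ?y a] a by simp
    ultimately show ?case using Suc a by auto
  qed
  then have *: "2 ^ n * (a - x) \<le> a" for n by (smt (verit))
  obtain n where "a / (a - x) < 2 ^ n" using real_arch_pow[of 2 "a / (a - x)"] by auto
  then have "a < 2 ^ n * (a - x)" using x by (simp add: divide_less_eq)
  with *[of n] show False by simp
qed

lemma above_fixed_point_increases:
  assumes a: "1/4 < a" "a < 1/2" "base_map a = a" and x: "a < x" "x \<le> a + 1"
  shows "x < base_map x"
proof (cases "x \<le> 3/4")
  case True
  then have "base_map x - base_map a \<ge> 2 * (x - a)"
    using a x by (intro base_map_doubles_distance slope_ge_2_middle) auto
  then have "base_map x - a \<ge> 2 * (x - a)" by (simp only: a(3))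
  then show ?thesis using x by argo
next
  case False
  have "base_map (- (1/4) + of_int 1) = 2 - base_map (1/4)"
    unfolding base_map_add_int base_map_odd by simp
  then have "base_map (3/4) > 7/4" using base_map_quarter by simp
  moreover have "base_map (3/4) < base_map x" using False by simp
  moreover have "x < 3/2" using a x by simp
  ultimately show ?thesis by linarith
qed

text \<open>
  A primitive of the steepness that remains continuous up to \<open>z\<close> from the left.  When \<open>z\<close> is outside
  the basin its derivative tends to infinity at \<open>z\<close>, but centre curves still reach the vertical line
  over \<open>z\<close> at a finite height.  The bound \<open>e < 1\<close> keeps the interval from winding around the circle.
\<close>

definition left_primitive :: "real \<Rightarrow> real \<Rightarrow> (real \<Rightarrow> real) \<Rightarrow> bool" where
  "left_primitive z e W \<longleftrightarrow> 0 < e \<and> e < 1 \<and> continuous_on {z - e..z} W \<and>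
     (\<forall>x\<in>{z - e<..<z}. x \<in> basin \<and> (W has_real_derivative 1 / tilt x) (at x))"

text \<open>
  The series whose termwise derivative is the steepness.  It is only of interest on \<open>{0..a}\<close> with
  \<open>a\<close> the repelling fixed point: there the iterates are bounded, which makes it converge
  uniformly, whereas the lifted iterates of other points may grow like \<open>2 ^ n\<close>.
\<close>

definition centre_height :: "real \<Rightarrow> real" where
  "centre_height x = (\<Sum>n. (1/2) ^ Suc n * (base_map ^^ n) x)"

lemma centre_height_term_deriv:
  "((\<lambda>x. (1/2) ^ Suc n * (base_map ^^ n) x) has_real_derivative weight n x) (at x)"
proof (induction n arbitrary: x)
  case 0
  show ?case by (rule derivative_eq_intros refl | simp)+
next
  case (Suc n)
  have "((\<lambda>x. 1/2 * ((1/2) ^ Suc n * (base_map ^^ n) (base_map x)))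
      has_real_derivative 1/2 * (weight n (base_map x) * slope x)) (at x)"
    by (intro DERIV_cmult DERIV_chain2[OF Suc base_map_deriv])
  then show ?case by (simp add: funpow_Suc_right mult_ac del: funpow.simps)
qed

lemma base_map_interval:
  assumes "base_map a = a" "0 \<le> x" "x \<le> a"
  shows "0 \<le> (base_map ^^ n) x" "(base_map ^^ n) x \<le> a"
proof -
  have "0 \<le> (base_map ^^ n) x \<and> (base_map ^^ n) x \<le> a"
  proof (induction n)
    case (Suc n)
    then show ?case using base_map_le_iff[of 0 "(base_map ^^ n) x"] base_map_le_iff[of "(base_map ^^ n) x" a] assms
      by simp
  qed (use assms in simp)
  then show "0 \<le> (base_map ^^ n) x" "(base_map ^^ n) x \<le> a" by auto
qed

lemma centre_height_term_bound:
  assumes "base_map a = a" "x \<in> {0..a}"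
  shows "norm ((1/2) ^ Suc n * (base_map ^^ n) x) \<le> (1/2) ^ Suc n * a"
  using base_map_interval[OF assms(1), of x n] assms(2) by (simp add: abs_mult)

lemma summable_half_powers: "summable (\<lambda>n. (1/2) ^ Suc n * (a::real))"
proof -
  have "summable (\<lambda>n. (1/2) ^ Suc n :: real)"
    using summable_geometric[of "1/2::real"] summable_Suc_iff[of "\<lambda>n. (1/2) ^ n :: real"] by simp
  then show ?thesis by (rule summable_mult2)
qed

lemma summable_centre_height:
  assumes "base_map a = a" "x \<in> {0..a}"
  shows "summable (\<lambda>n. (1/2) ^ Suc n * (base_map ^^ n) x)"
  by (rule summable_comparison_test[OF _ summable_half_powers[of a]])
    (use centre_height_term_bound[OF assms] in blast)

lemma continuous_centre_height:
  assumes "base_map a = a"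
  shows "continuous_on {0..a} centre_height"
proof -
  let ?t = "\<lambda>n x. (1/2) ^ Suc n * (base_map ^^ n) x"
  have "uniform_limit {0..a} (\<lambda>n x. \<Sum>i<n. ?t i x) (\<lambda>x. \<Sum>i. ?t i x) sequentially"
    by (rule Weierstrass_m_test[OF centre_height_term_bound[OF assms] summable_half_powers])
  moreover have "\<forall>\<^sub>F n in sequentially. continuous_on {0..a} (\<lambda>x. \<Sum>i<n. ?t i x)"
    by (intro always_eventually allI continuous_intros continuous_on_subset[OF continuous_funpow_base_map]) auto
  ultimately show ?thesis
    unfolding centre_height_def[abs_def]
    by (intro uniform_limit_theorem[of _ "\<lambda>n x. \<Sum>i<n. ?t i x" sequentially]) auto
qed

lemma centre_height_step:
  assumes "base_map a = a" "x \<in> {0..a}"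
  shows "centre_height x = (centre_height (base_map x) + x) / 2"
proof -
  have G: "base_map x \<in> {0..a}" using base_map_interval[OF assms(1), of x 1] assms(2) by simp
  have "(\<Sum>n. (1/2) ^ Suc (Suc n) * (base_map ^^ Suc n) x) = 1/2 * centre_height (base_map x)"
    unfolding centre_height_def using suminf_mult[OF summable_centre_height[OF assms(1) G], of "1/2"]
    by (simp add: funpow_Suc_right mult_ac del: funpow.simps)
  moreover have "centre_height x = (\<Sum>n. (1/2) ^ Suc (Suc n) * (base_map ^^ Suc n) x) + x / 2"
    unfolding centre_height_def using suminf_split_head[OF summable_centre_height[OF assms]] by simp
  ultimately show ?thesis by simp
qed

lemma centre_height_deriv:
  assumes a: "base_map a = a" and "x \<in> basin" "0 < x" "x < a"
  shows "(centre_height has_real_derivative steepness x) (at x)"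
  using assms(2-)
proof (induction x rule: basin_induct)
  case (core x)
  define e where "e = cos (2 * pi * x) / 2"
  define T where "T = {z. cos (2 * pi * z) > e}"
  have "open T" "x \<in> T" "e > 0"
    unfolding T_def e_def using core by (auto intro!: open_Collect_less continuous_intros)
  then obtain d where d: "d > 0" "ball x d \<subseteq> T" using openE by blast
  have "((\<lambda>x. \<Sum>n. (1/2) ^ Suc n * (base_map ^^ n) x) has_real_derivative (\<Sum>n. weight n x)) (at x)"
  proof (rule has_field_derivative_series'(2))
    show "convex (ball x d)" by simp
    show "((\<lambda>x. (1/2) ^ Suc n * (base_map ^^ n) x) has_real_derivative weight n y) (at y within ball x d)" for n y
      by (rule has_field_derivative_at_within[OF centre_height_term_deriv])
    have "uniform_limit (ball x d) (\<lambda>n z. \<Sum>i<n. weight i z) steepness sequentially"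
      by (rule uniform_limit_weight[OF \<open>e > 0\<close>]) (use d in \<open>force simp: T_def\<close>)
    then show "uniformly_convergent_on (ball x d) (\<lambda>n x. \<Sum>i<n. weight i x)"
      by (auto simp: uniformly_convergent_on_def)
    show "x \<in> ball x d" "x \<in> interior (ball x d)" using d by (simp_all add: interior_open)
    show "summable (\<lambda>n. (1/2) ^ Suc n * (base_map ^^ n) x)"
      by (rule summable_centre_height[OF a]) (use core in auto)
  qed
  then show ?case by (simp only: centre_height_def[abs_def] steepness_def)
next
  case (step x)
  have "0 < base_map x" "base_map x < a"
    using step base_map_less_iff[of 0 x] base_map_less_iff[of x a] a by auto
  then have "(centre_height has_real_derivative steepness (base_map x)) (at (base_map x))"
    by (rule step.IH)
  then have "((\<lambda>x. (centre_height (base_map x) + x) / 2) has_real_derivative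
      (steepness (base_map x) * slope x + 1) / 2) (at x)"
    by (intro DERIV_cdivide DERIV_add DERIV_chain2[OF _ base_map_deriv] DERIV_ident)
  moreover have "(steepness (base_map x) * slope x + 1) / 2 = steepness x"
    using steepness_step[of x] step by simp
  moreover have "\<forall>\<^sub>F z in nhds x. centre_height z = (centre_height (base_map z) + z) / 2"
    using eventually_nhds_in_open[of "{0<..<a}" x] step centre_height_step[OF a]
    by (auto elim!: eventually_mono)
  ultimately show ?case by (simp only: DERIV_cong_ev[OF refl _ refl])
qed

lemma left_primitive_fixed_point:
  assumes a: "1/4 < a" "a < 1/2" "base_map a = a"
  shows "left_primitive a a centre_height"
  unfolding left_primitive_def
  using a continuous_centre_height[OF a(3)] centre_height_deriv[OF a(3)] below_fixed_point_in_basin[OF a]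
  by (auto simp: tilt_def)

lemma left_primitive_translate:
  assumes "left_primitive z e W"
  shows "left_primitive (z + of_int k) e (\<lambda>x. W (x - of_int k))"
  unfolding left_primitive_def
proof (intro conjI ballI)
  show "0 < e" "e < 1" using assms by (auto simp: left_primitive_def)
  show "continuous_on {z + of_int k - e..z + of_int k} (\<lambda>x. W (x - of_int k))"
    by (rule continuous_on_compose2[of "{z - e..z}" W])
      (use assms in \<open>auto simp: left_primitive_def intro!: continuous_intros\<close>)
  fix x assume "x \<in> {z + of_int k - e<..<z + of_int k}"
  then have x: "x - of_int k \<in> {z - e<..<z}" by auto
  then show "x \<in> basin"
    using assms basin_add_int[of "x - of_int k" k] by (auto simp: left_primitive_def)
  have "(W has_real_derivative 1 / tilt (x - of_int k)) (at (x - of_int k))"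
    using assms x by (auto simp: left_primitive_def)
  then have "((\<lambda>x. W (x - of_int k)) has_real_derivative 1 / tilt (x - of_int k) * 1) (at x)"
    by (rule DERIV_chain2) (auto intro!: derivative_eq_intros)
  then show "((\<lambda>x. W (x - of_int k)) has_real_derivative 1 / tilt x) (at x)"
    using tilt_add_int[of "x - of_int k" k] by simp
qed

text \<open>
  The skew product maps centre curves to centre curves.  The image of the curve \<open>y = - V x\<close> under
  \<open>(x, y) \<mapsto> (base_map x, x + 2 * y)\<close> lies on \<open>y = - W x\<close> exactly when
  \<open>x - 2 * V x = - W (base_map x)\<close>, which gives the formula for \<open>V\<close>.
\<close>

lemma left_primitive_preimage:
  assumes "left_primitive (base_map z) e W"
  obtains e' where "left_primitive z e' (\<lambda>x. (W (base_map x) + x) / 2)"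
proof -
  have e: "0 < e" using assms by (auto simp: left_primitive_def)
  obtain y where y: "base_map y = base_map z - e" using base_map_surj by (metis surjD)
  then have "y < z" using e base_map_less_iff[of y z] by simp
  define e' where "e' = min (1/2) (z - y)"
  have e': "0 < e'" "e' < 1" "y \<le> z - e'" unfolding e'_def using \<open>y < z\<close> by auto
  have "left_primitive z e' (\<lambda>x. (W (base_map x) + x) / 2)"
    unfolding left_primitive_def
  proof (intro conjI ballI)
    show "0 < e'" "e' < 1" using e' by auto
    have "base_map ` {z - e'..z} \<subseteq> {base_map z - e..base_map z}"
      unfolding y[symmetric] using e' by auto
    moreover have "continuous_on {base_map z - e..base_map z} W"
      using assms by (simp add: left_primitive_def)
    ultimately have "continuous_on {z - e'..z} (\<lambda>x. W (base_map x))"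
      by (rule continuous_on_compose2[OF _ continuous_base_map, rotated])
    then show "continuous_on {z - e'..z} (\<lambda>x. (W (base_map x) + x) / 2)"
      by (intro continuous_intros) auto
    fix x assume x: "x \<in> {z - e'<..<z}"
    then have G: "base_map x \<in> {base_map z - e<..<base_map z}"
      using e' base_map_less_iff[of y x] base_map_less_iff[of x z] unfolding y by auto
    then have "base_map x \<in> basin" using assms unfolding left_primitive_def by blast
    then show "x \<in> basin" by simp
    have "(W has_real_derivative 1 / tilt (base_map x)) (at (base_map x))"
      using assms G unfolding left_primitive_def by blast
    then have "((\<lambda>x. (W (base_map x) + x) / 2) has_real_derivative
        (1 / tilt (base_map x) * slope x + 1) / 2) (at x)"
      by (intro DERIV_cdivide DERIV_add DERIV_chain2[OF _ base_map_deriv] DERIV_ident)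
    moreover have "(1 / tilt (base_map x) * slope x + 1) / 2 = 1 / tilt x"
      using steepness_step[OF \<open>x \<in> basin\<close>] \<open>x \<in> basin\<close> by (simp add: tilt_def)
    ultimately show "((\<lambda>x. (W (base_map x) + x) / 2) has_real_derivative 1 / tilt x) (at x)"
      by simp
  qed
  then show ?thesis by (rule that)
qed

text \<open>
  Working with the lift, the points are the backward orbit of \<open>a + 1\<close>, a translate of the
  repelling fixed point \<open>a\<close>.  The lift moves points of \<open>(a, a + 1]\<close> to the right, so this
  orbit decreases strictly inside that fundamental domain, and its points are distinct on the
  circle.
\<close>

lemma branch_points:
  obtains Z where "infinite Z" "countable Z"
    "\<And>x y. x \<in> Z \<Longrightarrow> y \<in> Z \<Longrightarrow> x - y \<in> \<int> \<Longrightarrow> x = y"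
    "\<And>z. z \<in> Z \<Longrightarrow> z \<notin> basin" "\<And>z. z \<in> Z \<Longrightarrow> \<exists>e W. left_primitive z e W"
proof -
  obtain a where a: "1/4 < a" "a < 1/2" "base_map a = a" by (rule repelling_fixed_point)
  \<comment> \<open>Starting from \<open>a\<close> itself would give nothing new, since \<open>a\<close> is fixed by the lift.\<close>
  define zs where "zs n = ((inv base_map) ^^ n) (a + 1)" for n
  have step: "base_map (zs (Suc n)) = zs n" for n
    by (simp add: zs_def surj_f_inv_f[OF base_map_surj])
  have a1: "base_map (a + of_int 1) = a + 2" unfolding base_map_add_int using a by simp
  have props: "a < zs n \<and> zs n \<le> a + 1 \<and> zs n \<notin> basin \<and> (\<exists>e W. left_primitive (zs n) e W)" for n
  proof (induction n)
    case 0
    have "a + of_int 1 \<notin> basin" using fixed_point_not_in_basin[OF a] basin_add_int by blast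
    moreover have "\<exists>e W. left_primitive (a + of_int 1) e W"
      using left_primitive_translate[OF left_primitive_fixed_point[OF a]] by blast
    ultimately show ?case by (simp add: zs_def)
  next
    case (Suc n)
    have "base_map a < base_map (zs (Suc n))" unfolding step using Suc a by simp
    moreover have "base_map (zs (Suc n)) \<le> base_map (a + of_int 1)"
      unfolding step a1 using Suc by linarith
    moreover have "base_map (zs (Suc n)) \<notin> basin" unfolding step using Suc by blast
    moreover have "\<exists>e W. left_primitive (zs (Suc n)) e W"
      using Suc left_primitive_preimage[of "zs (Suc n)"] unfolding step by metis
    ultimately show ?case by simp
  qed
  have "zs (Suc n) < zs n" for n
    using above_fixed_point_increases[OF a, of "zs (Suc n)"] props[of "Suc n"] unfolding step by blast
  then have "strict_mono (\<lambda>n. - zs n)" by (simp add: strict_mono_Suc_iff)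
  then have "inj (\<lambda>n. - zs n)" by (rule strict_mono_imp_inj_on)
  then have inj: "inj zs" by (simp add: inj_def)
  show ?thesis
  proof (rule that[of "range zs"])
    show "infinite (range zs)" using inj by (simp add: finite_image_iff)
    show "countable (range zs)" by simp
    fix z assume "z \<in> range zs"
    then show "z \<notin> basin" "\<exists>e W. left_primitive z e W" using props by auto
  next
    fix x y assume xy: "x \<in> range zs" "y \<in> range zs" "x - y \<in> \<int>"
    then obtain k where k: "x - y = of_int k" by (auto elim: Ints_cases)
    have "a < x" "x \<le> a + 1" "a < y" "y \<le> a + 1" using xy props by auto
    then have "\<bar>x - y\<bar> < 1" by linarith
    then have "k = 0" unfolding k by linarith
    with k show "x = y" by simp
  qed
qed

text \<open>
  Parametrised by height, a centre curve is a solution of \<open>\<xi>' = tilt \<xi>\<close>.  The inverse of \<open>W\<close> is a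
  solution that arrives at \<open>z\<close> at time \<open>0\<close>; as \<open>tilt\<close> vanishes at \<open>z\<close>, it can be continued by the
  constant \<open>z\<close>.  The glued function is differentiable at \<open>0\<close> because its derivative has the limit
  \<open>tilt z = 0\<close> there.
\<close>

lemma branch:
  assumes P: "left_primitive z e W" and z: "z \<notin> basin"
  obtains \<xi> d where "d > 0" "\<xi> 0 = z"
    "\<And>t. t \<in> {-d<..<d} \<Longrightarrow> (\<xi> has_real_derivative tilt (\<xi> t)) (at t)"
    "\<And>t. t \<in> {-d<..<0} \<Longrightarrow> z - 1 < \<xi> t \<and> \<xi> t < z"
proof -
  have e: "0 < e" "e < 1" and cont: "continuous_on {z - e..z} W"
    and deriv: "\<And>x. x \<in> {z - e<..<z} \<Longrightarrow> (W has_real_derivative 1 / tilt x) (at x)"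
    and basin: "\<And>x. x \<in> {z - e<..<z} \<Longrightarrow> x \<in> basin"
    using P by (auto simp: left_primitive_def)
  have mono: "W x < W y" if "x < y" "x \<in> {z - e..z}" "y \<in> {z - e..z}" for x y
  proof (rule DERIV_pos_imp_increasing_open[OF \<open>x < y\<close>])
    fix t assume "x < t" "t < y"
    then have "t \<in> {z - e<..<z}" using that by auto
    then show "\<exists>y. (W has_real_derivative y) (at t) \<and> 0 < y"
      using deriv basin tilt_pos by (meson zero_less_divide_1_iff)
  next
    show "continuous_on {x..y} W" by (rule continuous_on_subset[OF cont]) (use that in auto)
  qed
  have inj: "inj_on W {z - e..z}"
    by (rule inj_onI) (metis mono less_irrefl linorder_neqE_linordered_idom)
  define V where "V = inv_into {z - e..z} W"
  have VW: "V (W x) = x" if "x \<in> {z - e..z}" for x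
    unfolding V_def using inj that by (rule inv_into_f_f)
  \<comment> \<open>The time that the centre curve starting over \<open>z - e\<close> takes to reach \<open>z\<close>.\<close>
  define d where "d = W z - W (z - e)"
  have d: "d > 0" unfolding d_def using mono[of "z - e" z] e by simp
  define \<xi> where "\<xi> t = (if t \<le> 0 then V (W z + t) else z)" for t
  have img: "W ` {z - e..z} = {W z - d..W z}"
  proof
    show "W ` {z - e..z} \<subseteq> {W z - d..W z}"
      unfolding d_def using mono by (force simp: less_eq_real_def)
    show "{W z - d..W z} \<subseteq> W ` {z - e..z}"
    proof
      fix s assume "s \<in> {W z - d..W z}"
      then have "\<exists>x\<ge>z - e. x \<le> z \<and> W x = s"
        by (intro IVT' cont) (use e in \<open>auto simp: d_def\<close>)
      then show "s \<in> W ` {z - e..z}" by auto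
    qed
  qed
  have V_in: "V s \<in> {z - e<..<z} \<and> W (V s) = s" if "s \<in> {W z - d<..<W z}" for s
  proof -
    have "s \<in> W ` {z - e..z}" unfolding img using that by auto
    then obtain x where x: "x \<in> {z - e..z}" "W x = s" by blast
    then have "x \<noteq> z" "x \<noteq> z - e" using that d_def by auto
    then show ?thesis using x VW by auto
  qed
  have V_cont: "continuous_on {W z - d..W z} V"
    using continuous_on_inv[OF cont] VW unfolding img[symmetric] by auto
  have \<xi>0: "\<xi> 0 = z" unfolding \<xi>_def using VW[of z] e by simp
  have \<xi>_cont: "continuous_on {-d..d} \<xi>"
  proof -
    have "continuous_on ({-d..0} \<union> {0..d}) (\<lambda>t. if t \<le> 0 then V (W z + t) else z)"
    proof (rule continuous_on_cases)
      show "continuous_on {-d..0} (\<lambda>t. V (W z + t))"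
        by (rule continuous_on_compose2[OF V_cont]) (auto intro!: continuous_intros)
      show "\<forall>t. t \<in> {-d..0} \<and> \<not> t \<le> 0 \<or> t \<in> {0..d} \<and> t \<le> 0 \<longrightarrow> V (W z + t) = z"
        using VW[of z] e by auto
    qed auto
    moreover have "{-d..0} \<union> {0..d} = {-d..d}" using d by auto
    ultimately show ?thesis unfolding \<xi>_def by simp
  qed
  have left: "(\<xi> has_real_derivative tilt (\<xi> t)) (at t)" if t: "t \<in> {-d<..<0}" for t
  proof -
    define x where "x = V (W z + t)"
    have x: "x \<in> {z - e<..<z}" "W x = W z + t" unfolding x_def using V_in[of "W z + t"] t by auto
    have "(V has_real_derivative 1 / (1 / tilt x)) (at (W x))"
    proof (rule DERIV_local_inverse[where f = W and x = x and S = "{z - e<..<z}"])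
      show "(W has_real_derivative 1 / tilt x) (at x)" by (rule deriv[OF x(1)])
      show "1 / tilt x \<noteq> 0" using tilt_pos[OF basin[OF x(1)]] by simp
      show "open {z - e<..<z}" "x \<in> {z - e<..<z}" using x by auto
      show "continuous_on {z - e<..<z} W" by (rule continuous_on_subset[OF cont]) auto
      show "V (W y) = y" if "y \<in> {z - e<..<z}" for y using VW that by auto
    qed
    then have "(V has_real_derivative tilt x) (at (W z + t))" using x by simp
    then have "((\<lambda>t. V (W z + t)) has_real_derivative tilt x * 1) (at t)"
      by (rule DERIV_chain2) (auto intro!: derivative_eq_intros)
    then have "((\<lambda>t. V (W z + t)) has_real_derivative tilt x) (at t)" by simp
    moreover have "\<forall>\<^sub>F s in nhds t. \<xi> s = V (W z + s)"
      using eventually_nhds_in_open[of "{..<0}" t] t by (auto elim!: eventually_mono simp: \<xi>_def)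
    ultimately have "(\<xi> has_real_derivative tilt x) (at t)"
      by (simp only: DERIV_cong_ev[OF refl _ refl])
    then show ?thesis using t by (simp add: \<xi>_def x_def)
  qed
  have right: "(\<xi> has_real_derivative tilt (\<xi> t)) (at t)" if t: "t > 0" for t
  proof -
    have "\<forall>\<^sub>F s in nhds t. \<xi> s = z"
      using eventually_nhds_in_open[of "{0<..}" t] t by (auto elim!: eventually_mono simp: \<xi>_def)
    then have "(\<xi> has_real_derivative 0) (at t)"
      using DERIV_cong_ev[OF refl, of \<xi> "\<lambda>_. z" t 0 0] by simp
    then show ?thesis using t z by (simp add: \<xi>_def tilt_outside)
  qed
  have \<xi>_isCont: "isCont \<xi> 0"
    using \<xi>_cont d by (auto intro: continuous_on_interior)
  have zero: "(\<xi> has_real_derivative tilt (\<xi> 0)) (at 0)"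
    unfolding DERIV_def add_0
  proof (rule lhopital[where g' = "\<lambda>_. 1" and f' = "\<lambda>t. tilt (\<xi> t)"])
    show "(\<lambda>t. \<xi> t - \<xi> 0) \<midarrow>0\<rightarrow> 0" using \<xi>_isCont unfolding isCont_def by (simp add: LIM_zero)
    have near: "\<forall>\<^sub>F t in at 0. t \<in> {-d<..<d} \<and> t \<noteq> 0"
      using eventually_at_in_open[of "{-d<..<d}" 0] d by (auto elim!: eventually_mono)
    show "\<forall>\<^sub>F t in at 0. ((\<lambda>t. \<xi> t - \<xi> 0) has_real_derivative tilt (\<xi> t)) (at t)"
      using near
    proof eventually_elim
      case (elim t)
      then have "(\<xi> has_real_derivative tilt (\<xi> t)) (at t)"
        by (cases "t < 0") (auto intro: left right)
      then show ?case by (auto intro!: derivative_eq_intros)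
    qed
    show "\<forall>\<^sub>F t in at 0. (t::real) \<noteq> 0" by (simp add: eventually_at_filter)
    have "isCont (\<lambda>t. tilt (\<xi> t)) 0" by (rule isCont_o2[OF \<xi>_isCont isCont_tilt])
    then show "(\<lambda>t. tilt (\<xi> t) / 1) \<midarrow>0\<rightarrow> tilt (\<xi> 0)" by (simp add: isCont_def)
  qed (auto intro!: derivative_eq_intros)
  show ?thesis
  proof (rule that[of d \<xi>, OF d \<xi>0])
    show "(\<xi> has_real_derivative tilt (\<xi> t)) (at t)" if "t \<in> {-d<..<d}" for t
      using left[of t] right[of t] zero that by (cases "t = 0"; cases "t < 0") auto
    show "z - 1 < \<xi> t \<and> \<xi> t < z" if "t \<in> {-d<..<0}" for t
      using V_in[of "W z + t"] that e by (auto simp: \<xi>_def)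
  qed
qed

section \<open>Topology of the torus\<close>

lemma torus_proj_eq_iff: "torus_proj x = torus_proj y \<longleftrightarrow> same_mod_lattice x y"
  by (rule torus.abs_eq_iff)

lemma torus_cases: obtains x where "p = torus_proj x"
  by (metis Quotient3_abs_rep Quotient3_torus)

lemma same_mod_lattice_near_eq:
  assumes "same_mod_lattice x y" "norm (x - y) < 1"
  shows "x = y"
proof -
  have "x $ i = y $ i" for i
  proof -
    obtain k where k: "x $ i - y $ i = of_int k"
      using assms(1) by (auto simp: same_mod_lattice_def elim: Ints_cases)
    have "\<bar>(x - y) $ i\<bar> < 1" using component_le_norm_cart[of "x - y" i] assms(2) by linarith
    then have "k = 0" unfolding vector_minus_component k by linarith
    with k show ?thesis by simp
  qed
  then show ?thesis by (simp add: vec_eq_iff)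
qed

lemma torus_proj_diff_eq: "torus_proj x = torus_proj y \<Longrightarrow> torus_proj (z + x - y) = torus_proj z"
  unfolding torus_proj_eq_iff same_mod_lattice_def by (simp add: algebra_simps)

lemma open_vimage_torus_proj: "open U \<Longrightarrow> open (torus_proj -` U)"
  by (simp add: open_torus_def)

lemma open_image_torus_proj:
  assumes "open S" shows "open (torus_proj ` S)"
proof -
  have "torus_proj -` (torus_proj ` S) = (\<Union>v\<in>{v. \<forall>i. v $ i \<in> \<int>}. (+) v ` S)" (is "?L = ?R")
  proof (intro set_eqI iffI)
    fix y assume "y \<in> ?L"
    then obtain x where x: "x \<in> S" "torus_proj y = torus_proj x" by auto
    then have "\<forall>i. (y - x) $ i \<in> \<int>" by (simp add: torus_proj_eq_iff same_mod_lattice_def)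
    moreover have "y = (y - x) + x" by simp
    ultimately show "y \<in> ?R" using x by blast
  next
    fix y assume "y \<in> ?R"
    then obtain v x where "\<forall>i. v $ i \<in> \<int>" "x \<in> S" "y = v + x" by auto
    then have "torus_proj y = torus_proj x" by (simp add: torus_proj_eq_iff same_mod_lattice_def)
    then show "y \<in> ?L" using \<open>x \<in> S\<close> by auto
  qed
  moreover have "open ?R" using assms by (intro open_UN ballI open_translation)
  ultimately show ?thesis by (simp only: open_torus_def)
qed

text \<open>
  The projection is continuous and open, so limits at a point of the torus can be computed at any
  one of its lifts.
\<close>

lemma nhds_torus_proj: "nhds (torus_proj x) = filtermap torus_proj (nhds x)"
proof (rule filter_eqI)
  fix P
  show "eventually P (nhds (torus_proj x)) \<longleftrightarrow> eventually P (filtermap torus_proj (nhds x))"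
    unfolding eventually_filtermap
  proof
    assume "eventually P (nhds (torus_proj x))"
    then obtain U where "open U" "torus_proj x \<in> U" "\<forall>y\<in>U. P y" by (auto simp: eventually_nhds)
    then show "\<forall>\<^sub>F y in nhds x. P (torus_proj y)"
      using open_vimage_torus_proj[of U] by (auto simp: eventually_nhds intro!: exI[of _ "torus_proj -` U"])
  next
    assume "\<forall>\<^sub>F y in nhds x. P (torus_proj y)"
    then obtain S where "open S" "x \<in> S" "\<forall>y\<in>S. P (torus_proj y)" by (auto simp: eventually_nhds)
    then show "eventually P (nhds (torus_proj x))"
      using open_image_torus_proj[of S] by (auto simp: eventually_nhds intro!: exI[of _ "torus_proj ` S"])
  qed
qed

lemma tendsto_torus_iff:
  "(D \<longlongrightarrow> D (torus_proj x)) (nhds (torus_proj x)) \<longleftrightarrow> isCont (\<lambda>y. D (torus_proj y)) x"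
  unfolding isCont_iff_tendsto_nhds nhds_torus_proj filterlim_filtermap by simp

lemma isCont_torus_proj: "isCont torus_proj x"
  unfolding isCont_iff_tendsto_nhds nhds_torus_proj by (simp add: filterlim_def)

lemma continuous_on_torusI:
  assumes "\<And>p. p \<in> S \<Longrightarrow> \<exists>x. torus_proj x = p \<and> isCont (\<lambda>y. D (torus_proj y)) x"
  shows "continuous_on S D"
  unfolding continuous_on_def
proof
  fix p assume "p \<in> S"
  then obtain x where "p = torus_proj x" "isCont (\<lambda>y. D (torus_proj y)) x" using assms by blast
  then have "(D \<longlongrightarrow> D p) (nhds p)" by (simp only: tendsto_torus_iff)
  then show "(D \<longlongrightarrow> D p) (at p within S)" by (rule tendsto_mono[OF at_within_le_nhds])
qed

section \<open>Coordinates of the plane\<close>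

definition pt :: "real \<Rightarrow> real \<Rightarrow> real^2" where
  "pt a b = a *\<^sub>R axis 1 1 + b *\<^sub>R axis 2 1"

lemma pt_nth [simp]: "pt a b $ 1 = a" "pt a b $ 2 = b"
  by (simp_all add: pt_def axis_def)

lemma pt_eq_iff: "v = w \<longleftrightarrow> v $ 1 = w $ 1 \<and> v $ 2 = w $ (2::2)"
  by (simp add: vec_eq_iff forall_2)

lemma pt_nth_nth [simp]: "pt (v $ 1) (v $ 2) = v"
  by (simp add: pt_eq_iff)

lemma same_mod_lattice_iff: "same_mod_lattice x y \<longleftrightarrow> x $ 1 - y $ 1 \<in> \<int> \<and> x $ 2 - y $ 2 \<in> \<int>"
  by (simp add: same_mod_lattice_def forall_2)

lemma has_derivative_pt:
  assumes "(f has_derivative f') F" "(g has_derivative g') F"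
  shows "((\<lambda>x. pt (f x) (g x)) has_derivative (\<lambda>h. pt (f' h) (g' h))) F"
  unfolding pt_def by (intro has_derivative_add has_derivative_scaleR_left assms)

lemma has_vector_derivative_pt:
  assumes "(f has_real_derivative f') F" "(g has_real_derivative g') F"
  shows "((\<lambda>x. pt (f x) (g x)) has_vector_derivative pt f' g') F"
  unfolding has_vector_derivative_def
proof (rule has_derivative_eq_rhs)
  show "((\<lambda>x. pt (f x) (g x)) has_derivative (\<lambda>h. pt (f' * h) (g' * h))) F"
    using assms unfolding has_field_derivative_def by (rule has_derivative_pt)
qed (simp add: fun_eq_iff pt_eq_iff)

lemma has_real_derivative_nth:
  assumes "(c has_vector_derivative v) F"
  shows "((\<lambda>t. c t $ i) has_real_derivative v $ i) F"
  using bounded_linear.has_vector_derivative[OF bounded_linear_vec_nth assms, of i]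
  by (simp add: has_real_derivative_iff_has_vector_derivative)

lemma continuous_pt [continuous_intros]:
  assumes "continuous F f" "continuous F g"
  shows "continuous F (\<lambda>x. pt (f x) (g x))"
  unfolding pt_def by (intro continuous_intros assms)

lemma continuous_on_pt [continuous_intros]:
  assumes "continuous_on S f" "continuous_on S g"
  shows "continuous_on S (\<lambda>x. pt (f x) (g x))"
  unfolding pt_def by (intro continuous_intros assms)

lemma continuous_nth [continuous_intros]: "continuous F f \<Longrightarrow> continuous F (\<lambda>x. f x $ i)"
  unfolding continuous_def by (rule tendsto_vec_nth)

definition mat2 :: "'a \<Rightarrow> 'a \<Rightarrow> 'a \<Rightarrow> 'a \<Rightarrow> 'a^2^2" where
  "mat2 a b c d = (\<chi> i j. if i = 1 then (if j = 1 then a else b) else (if j = 1 then c else d))"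

lemma mat2_nth [simp]:
  "mat2 a b c d $ 1 $ 1 = a" "mat2 a b c d $ 1 $ 2 = b"
  "mat2 a b c d $ 2 $ 1 = c" "mat2 a b c d $ 2 $ 2 = d"
  by (simp_all add: mat2_def)

lemma mat2_mult_vec: "mat2 a b c d *v v = pt (a * v $ 1 + b * v $ 2) (c * v $ 1 + d * v $ 2)"
  by (simp add: pt_eq_iff matrix_vector_mult_def sum_2)

lemma continuous_mat2 [continuous_intros]:
  assumes "continuous F a" "continuous F b" "continuous F c" "continuous F d"
  shows "continuous F (\<lambda>x. mat2 (a x) (b x) (c x) (d x) :: real^2^2)"
  unfolding continuous_def
proof (intro vec_tendstoI)
  fix i j :: 2
  show "((\<lambda>x. mat2 (a x) (b x) (c x) (d x) $ i $ j) \<longlongrightarrow>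
      mat2 (a (Lim F (\<lambda>x. x))) (b (Lim F (\<lambda>x. x))) (c (Lim F (\<lambda>x. x))) (d (Lim F (\<lambda>x. x))) $ i $ j) F"
    using assms exhaust_2[of i] exhaust_2[of j] by (auto simp: continuous_def)
qed

section \<open>Derivatives and lifts\<close>

text \<open>
  The difference of two lifts takes values in the lattice, where continuity forces it to be
  constant.
\<close>

lemma lattice_valued_locally_constant:
  fixes F H :: "'a::t2_space \<Rightarrow> real^2"
  assumes "\<forall>\<^sub>F y in nhds x. torus_proj (F y) = torus_proj (H y)" "isCont F x" "isCont H x"
  shows "\<forall>\<^sub>F y in nhds x. H y = F y + (H x - F x)"
proof -
  have "isCont (\<lambda>y. H y - F y) x" by (intro continuous_intros assms)
  then have "\<forall>\<^sub>F y in nhds x. dist (H y - F y) (H x - F x) < 1"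
    unfolding isCont_iff_tendsto_nhds by (rule tendstoD) simp
  with assms(1) show ?thesis
  proof eventually_elim
    case (elim y)
    have "torus_proj (F x) = torus_proj (H x)"
      using assms(1) by (rule eventually_nhds_x_imp_x)
    then have "same_mod_lattice (H y - F y) (H x - F x)"
      using elim unfolding torus_proj_eq_iff same_mod_lattice_def
      by (metis Ints_diff Ints_minus minus_diff_eq vector_minus_component)
    then have "H y - F y = H x - F x"
      using elim by (intro same_mod_lattice_near_eq) (auto simp: dist_norm)
    then show ?case by (simp add: algebra_simps)
  qed
qed

lemma has_derivative_eventually_eq:
  assumes "(f has_derivative f') (at x)" "\<forall>\<^sub>F y in nhds x. f y = g y"
  shows "(g has_derivative f') (at x)"
proof (rule has_derivative_transform_eventually[OF assms(1)])
  show "\<forall>\<^sub>F y in at x. f y = g y" using assms(2) by (rule filter_leD[OF at_within_le_nhds])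
  show "f x = g x" using assms(2) by (rule eventually_nhds_x_imp_x)
qed simp

lemma torus_has_deriv_unique:
  assumes "torus_has_deriv f A p" "torus_has_deriv f B p"
  shows "A = B"
proof -
  obtain x F where x: "torus_proj x = p" "\<forall>\<^sub>F y in nhds x. torus_proj (F y) = f (torus_proj y)"
    "(F has_derivative (\<lambda>v. A *v v)) (at x)"
    using assms(1) by (auto simp: torus_has_deriv_def)
  obtain x' H where x': "torus_proj x' = p" "\<forall>\<^sub>F y in nhds x'. torus_proj (H y) = f (torus_proj y)"
    "(H has_derivative (\<lambda>v. B *v v)) (at x')"
    using assms(2) by (auto simp: torus_has_deriv_def)
  \<comment> \<open>The two lifts may be based at different representatives of \<open>p\<close>; translate one to the other.\<close>
  let ?H = "\<lambda>y. H (y + (x' - x))"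
  have shift: "torus_proj (y + (x' - x)) = torus_proj y" for y
    using torus_proj_diff_eq[of x' x y] x x' by (simp add: algebra_simps)
  have "filterlim (\<lambda>y. y + (x' - x)) (nhds x') (nhds x)"
  proof -
    have "((\<lambda>y. y + (x' - x)) \<longlongrightarrow> x + (x' - x)) (nhds x)"
      by (intro tendsto_intros) (simp add: filterlim_def)
    then show ?thesis by simp
  qed
  from eventually_compose_filterlim[OF x'(2) this]
  have H: "\<forall>\<^sub>F y in nhds x. torus_proj (?H y) = f (torus_proj y)" by (simp only: shift)
  have "((\<lambda>y. y + (x' - x)) has_derivative (\<lambda>v. v)) (at x)"
    by (auto intro!: derivative_eq_intros)
  moreover have "(H has_derivative (\<lambda>v. B *v v)) (at (x + (x' - x)))" using x' by simp
  ultimately have dH: "(?H has_derivative (\<lambda>v. B *v v)) (at x)"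
    by (rule has_derivative_compose)
  have "\<forall>\<^sub>F y in nhds x. torus_proj (F y) = torus_proj (?H y)"
    using x(2) H by eventually_elim simp
  then have "\<forall>\<^sub>F y in nhds x. ?H y = F y + (?H x - F x)"
    by (rule lattice_valued_locally_constant[OF _ has_derivative_continuous[OF x(3)]
          has_derivative_continuous[OF dH]])
  moreover have "((\<lambda>y. F y + (?H x - F x)) has_derivative (\<lambda>v. A *v v)) (at x)"
    using x(3) by (auto intro!: derivative_eq_intros)
  ultimately have "(?H has_derivative (\<lambda>v. A *v v)) (at x)"
    by (intro has_derivative_eventually_eq[where g = ?H]) (auto elim: eventually_mono)
  then have "(\<lambda>v. A *v v) = (\<lambda>v. B *v v)" using dH by (rule has_derivative_unique)
  then show ?thesis by (simp add: matrix_eq fun_eq_iff)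
qed

lemma torus_deriv_eqI:
  assumes "torus_has_deriv f D p" shows "torus_deriv f p = D"
  unfolding torus_deriv_def
  using assms torus_has_deriv_unique by (intro the_equality) blast+

lemma torus_has_deriv_lift:
  assumes "\<And>y. torus_proj (F y) = f (torus_proj y)" "(F has_derivative (\<lambda>v. D *v v)) (at x)"
  shows "torus_has_deriv f D (torus_proj x)"
  unfolding torus_has_deriv_def using assms by (auto intro!: exI[of _ x] exI[of _ F])

lemma curve_has_velocity_proj:
  assumes "(c has_vector_derivative v) (at t)"
  shows "curve_has_velocity (\<lambda>s. torus_proj (c s)) v t"
  unfolding curve_has_velocity_def using assms by (auto intro!: exI[of _ c])

text \<open>
  The velocity at \<open>0\<close> supplies a lift that is known to be continuous only at \<open>0\<close>.  It stays close
  to its value there, while the lifts supplied at the nearby times \<open>t\<close> are continuous at \<open>t\<close>; the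
  difference of the two is a lattice vector that varies by less than \<open>1\<close>, hence not at all.  So the
  first lift inherits the velocities at all nearby times.
\<close>

lemma curve_lift:
  assumes I: "open I" "0 \<in> I" and x0: "\<gamma> 0 = torus_proj x0"
    and vel: "\<And>t. t \<in> I \<Longrightarrow> curve_has_velocity \<gamma> (\<gamma>' t) t"
  obtains e c where "e > 0" "{-e<..<e} \<subseteq> I" "c 0 = x0"
    "\<And>t. t \<in> {-e<..<e} \<Longrightarrow> torus_proj (c t) = \<gamma> t"
    "\<And>t. t \<in> {-e<..<e} \<Longrightarrow> (c has_vector_derivative \<gamma>' t) (at t)"
proof -
  obtain b where b: "\<forall>\<^sub>F s in nhds 0. torus_proj (b s) = \<gamma> s" "(b has_vector_derivative \<gamma>' 0) (at 0)"
    using vel[OF I(2)] by (auto simp: curve_has_velocity_def)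
  define c where "c s = b s + x0 - b 0" for s
  have "torus_proj x0 = torus_proj (b 0)"
    using eventually_nhds_x_imp_x[OF b(1)] x0 by simp
  then have proj_c: "torus_proj (c s) = torus_proj (b s)" for s
    unfolding c_def by (rule torus_proj_diff_eq)
  have "isCont b 0" by (rule has_vector_derivative_continuous[OF b(2)])
  then have "isCont c 0" unfolding c_def by (intro continuous_intros)
  moreover have c0: "c 0 = x0" by (simp add: c_def)
  ultimately have "(c \<longlongrightarrow> x0) (nhds 0)" unfolding isCont_iff_tendsto_nhds by simp
  from tendstoD[OF this, of "1/4"] have near: "\<forall>\<^sub>F s in nhds 0. dist (c s) x0 < 1/4" by simp
  have "\<forall>\<^sub>F s in nhds 0. s \<in> I \<and> torus_proj (c s) = \<gamma> s \<and> dist (c s) x0 < 1/4"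
    using eventually_nhds_in_open[OF I] b(1) near by eventually_elim (simp add: proj_c)
  then obtain e where e: "e > 0"
    "\<And>s. dist s 0 < e \<Longrightarrow> s \<in> I \<and> torus_proj (c s) = \<gamma> s \<and> dist (c s) x0 < 1/4"
    unfolding eventually_nhds_metric by blast
  then have on: "s \<in> I" "torus_proj (c s) = \<gamma> s" "dist (c s) x0 < 1/4" if "s \<in> {-e<..<e}" for s
    using that by (auto simp: dist_real_def abs_less_iff)
  have deriv: "(c has_vector_derivative \<gamma>' t) (at t)" if t: "t \<in> {-e<..<e}" for t
  proof -
    obtain g where g: "\<forall>\<^sub>F s in nhds t. torus_proj (g s) = \<gamma> s" "(g has_vector_derivative \<gamma>' t) (at t)"
      using vel[OF on(1)[OF t]] by (auto simp: curve_has_velocity_def)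
    have "(g \<longlongrightarrow> g t) (nhds t)"
      using has_vector_derivative_continuous[OF g(2)] unfolding isCont_iff_tendsto_nhds .
    from tendstoD[OF this, of "1/4"] have "\<forall>\<^sub>F s in nhds t. dist (g s) (g t) < 1/4" by simp
    moreover have "\<forall>\<^sub>F s in nhds t. s \<in> {-e<..<e}"
      by (rule eventually_nhds_in_open) (use t in auto)
    ultimately have "\<forall>\<^sub>F s in nhds t. g s + (c t - g t) = c s"
      using g(1)
    proof eventually_elim
      case (elim s)
      have "torus_proj (g t) = torus_proj (c t)"
        using eventually_nhds_x_imp_x[OF g(1)] on[OF t] by simp
      moreover have "torus_proj (g s) = torus_proj (c s)" using elim on by simp
      ultimately have "same_mod_lattice (g s - c s) (g t - c t)"
        unfolding torus_proj_eq_iff same_mod_lattice_def by (metis Ints_diff vector_minus_component)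
      moreover have "norm ((g s - c s) - (g t - c t)) < 1"
      proof -
        have "(g s - c s) - (g t - c t) = (g s - g t) - ((c s - x0) - (c t - x0))" by simp
        also have "norm \<dots> \<le> norm (g s - g t) + (norm (c s - x0) + norm (c t - x0))"
          by (intro order_trans[OF norm_triangle_ineq4] add_left_mono norm_triangle_ineq4)
        also have "\<dots> < 1" using elim on(3)[of s] on(3)[OF t] by (simp add: dist_norm)
        finally show ?thesis .
      qed
      ultimately have "g s - c s = g t - c t" by (rule same_mod_lattice_near_eq)
      then show ?case by (simp add: algebra_simps)
    qed
    moreover have "((\<lambda>s. g s + (c t - g t)) has_vector_derivative \<gamma>' t) (at t)"
      using g(2) by (auto intro!: derivative_eq_intros)
    ultimately show ?thesis
      unfolding has_vector_derivative_def by (rule has_derivative_eventually_eq[rotated])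
  qed
  show ?thesis by (rule that[of e c, OF e(1) _ c0]) (use on deriv in auto)
qed

section \<open>The skew product\<close>

definition lifted_map :: "real^2 \<Rightarrow> real^2" where
  "lifted_map v = pt (base_map (v $ 1)) (v $ 1 + 2 * v $ 2)"

definition lifted_inverse :: "real^2 \<Rightarrow> real^2" where
  "lifted_inverse v = pt (inv base_map (v $ 1)) ((v $ 2 - inv base_map (v $ 1)) / 2)"

lemma eq_add_int_if_diff_Ints:
  assumes "x - y \<in> \<int>" obtains k where "x = y + real_of_int k"
  using assms by (metis Ints_cases add.commute diff_add_cancel)

lift_definition torus_map :: "torus \<Rightarrow> torus" is lifted_map
proof -
  fix x y :: "real^2"
  assume *: "same_mod_lattice x y"
  then obtain k where k: "x $ 1 = y $ 1 + of_int k"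
    unfolding same_mod_lattice_iff using eq_add_int_if_diff_Ints by blast
  have "(x $ 1 - y $ 1) + (x $ 2 - y $ 2) + (x $ 2 - y $ 2) \<in> \<int>"
    using * unfolding same_mod_lattice_iff by (intro Ints_add) auto
  then show "same_mod_lattice (lifted_map x) (lifted_map y)"
    unfolding same_mod_lattice_iff lifted_map_def pt_nth k base_map_add_int by (simp add: algebra_simps)
qed

lift_definition tilt_at :: "torus \<Rightarrow> real" is "\<lambda>v. tilt (v $ 1)"
  unfolding same_mod_lattice_iff by (metis eq_add_int_if_diff_Ints tilt_add_int)

lift_definition slope_at :: "torus \<Rightarrow> real" is "\<lambda>v. slope (v $ 1)"
  unfolding same_mod_lattice_iff by (metis eq_add_int_if_diff_Ints slope_add_int)

declare torus_map.abs_eq [simp] tilt_at.abs_eq [simp] slope_at.abs_eq [simp]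

lemma isCont_nth: "isCont (\<lambda>v::real^2. v $ i) v"
  by (intro continuous_intros)

lemma base_map_inverse [simp]: "inv base_map (base_map x) = x" "base_map (inv base_map x) = x"
  using base_map_inj base_map_surj by (simp_all add: surj_f_inv_f)

lemma base_map_inverse_deriv: "(inv base_map has_real_derivative 1 / slope x) (at (base_map x))"
  by (rule DERIV_local_inverse[where S = UNIV])
    (use continuous_base_map base_map_deriv slope_pos[of x] in auto)

lemma lifted_inverse [simp]:
  "lifted_inverse (lifted_map v) = v" "lifted_map (lifted_inverse v) = v"
  by (simp_all add: lifted_map_def lifted_inverse_def pt_eq_iff diff_divide_distrib)

lemma lifted_map_deriv:
  "(lifted_map has_derivative (\<lambda>v. mat2 (slope (x $ 1)) 0 1 2 *v v)) (at x)"
proof -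
  have "(base_map has_derivative (*) (slope (x $ 1))) (at (x $ 1))"
    using base_map_deriv[of "x $ 1"] by (simp add: has_field_derivative_def)
  then have "((\<lambda>v. base_map (v $ 1)) has_derivative (\<lambda>v. slope (x $ 1) * v $ 1)) (at x)"
    by (rule has_derivative_compose[OF bounded_linear_imp_has_derivative[OF bounded_linear_vec_nth]])
  moreover have "((\<lambda>v. v $ 1 + 2 * v $ 2) has_derivative (\<lambda>v. v $ 1 + 2 * v $ 2)) (at x)"
    by (intro has_derivative_add has_derivative_mult_right bounded_linear_imp_has_derivative bounded_linear_vec_nth)
  ultimately have "((\<lambda>v. pt (base_map (v $ 1)) (v $ 1 + 2 * v $ 2)) has_derivative
      (\<lambda>v. pt (slope (x $ 1) * v $ 1) (v $ 1 + 2 * v $ 2))) (at x)"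
    by (rule has_derivative_pt)
  then show ?thesis by (simp add: lifted_map_def[abs_def] mat2_mult_vec)
qed

lemma lifted_inverse_deriv:
  fixes x :: "real^2" defines "s \<equiv> slope (x $ 1)"
  shows "(lifted_inverse has_derivative (\<lambda>v. mat2 (1 / s) 0 (- 1 / (2 * s)) (1 / 2) *v v)) (at (lifted_map x))"
proof -
  have "(inv base_map has_derivative (*) (1 / s)) (at (lifted_map x $ 1))"
    using base_map_inverse_deriv[of "x $ 1"] by (simp add: has_field_derivative_def lifted_map_def s_def)
  then have *: "((\<lambda>v. inv base_map (v $ 1)) has_derivative (\<lambda>v. 1 / s * v $ 1)) (at (lifted_map x))"
    by (rule has_derivative_compose[OF bounded_linear_imp_has_derivative[OF bounded_linear_vec_nth]])
  moreover have "((\<lambda>v. (v $ 2 - inv base_map (v $ 1)) * (1/2)) has_derivative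
      (\<lambda>v. (v $ 2 - 1 / s * v $ 1) * (1/2))) (at (lifted_map x))"
    by (intro has_derivative_mult_left has_derivative_diff * bounded_linear_imp_has_derivative bounded_linear_vec_nth)
  ultimately have "((\<lambda>v. pt (inv base_map (v $ 1)) ((v $ 2 - inv base_map (v $ 1)) * (1/2))) has_derivative
      (\<lambda>v. pt (1 / s * v $ 1) ((v $ 2 - 1 / s * v $ 1) * (1/2)))) (at (lifted_map x))"
    by (rule has_derivative_pt)
  moreover have "s \<noteq> 0" unfolding s_def using slope_pos[of "x $ 1"] by simp
  ultimately show ?thesis
    by (simp add: lifted_inverse_def[abs_def] mat2_mult_vec diff_divide_distrib mult.commute)
qed

lemma isCont_lifted_map: "isCont lifted_map x"
  by (rule has_derivative_continuous[OF lifted_map_deriv])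

lemma isCont_lifted_inverse: "isCont lifted_inverse x"
  using has_derivative_continuous[OF lifted_inverse_deriv[of "lifted_inverse x"]] by simp

definition map_jacobian :: "torus \<Rightarrow> real^2^2" where
  "map_jacobian p = mat2 (slope_at p) 0 1 2"

lemma torus_map_has_deriv: "torus_has_deriv torus_map (map_jacobian p) p"
proof -
  obtain x where p: "p = torus_proj x" by (rule torus_cases)
  show ?thesis unfolding p map_jacobian_def
    by (rule torus_has_deriv_lift[where F = lifted_map]) (use lifted_map_deriv in auto)
qed

lemma torus_deriv_torus_map: "torus_deriv torus_map p = map_jacobian p"
  by (rule torus_deriv_eqI[OF torus_map_has_deriv])

lemma torus_C1_torus_map: "torus_C1_on U torus_map"
  unfolding torus_C1_on_def
proof (intro exI[of _ map_jacobian] conjI ballI torus_map_has_deriv continuous_on_torusI)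
  fix p obtain x where p: "p = torus_proj x" by (rule torus_cases)
  have "isCont (\<lambda>y. mat2 (slope (y $ 1)) 0 1 2 :: real^2^2) x"
    by (intro continuous_intros isCont_o2[OF isCont_nth isCont_slope])
  then show "\<exists>x. torus_proj x = p \<and> isCont (\<lambda>y. map_jacobian (torus_proj y)) x"
    by (intro exI[of _ x]) (simp add: p map_jacobian_def)
qed

text \<open>
  The lift is a global diffeomorphism of the plane.  On a ball so small that its image has diameter
  less than \<open>1\<close>, distinct points have images that differ by no lattice vector, so the map is
  injective on the projection of the ball, and its inverse lifts to \<open>lifted_inverse\<close>.
\<close>

lemma torus_map_local_diffeo: "torus_local_diffeo torus_map"
  unfolding torus_local_diffeo_def
proof
  fix p
  obtain x0 where p: "p = torus_proj x0" by (rule torus_cases)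
  have "(lifted_map \<longlongrightarrow> lifted_map x0) (nhds x0)"
    using isCont_lifted_map unfolding isCont_iff_tendsto_nhds .
  then have "\<forall>\<^sub>F y in nhds x0. dist (lifted_map y) (lifted_map x0) < 1/2" by (rule tendstoD) simp
  then obtain r where r: "r > 0" "\<And>y. dist y x0 < r \<Longrightarrow> dist (lifted_map y) (lifted_map x0) < 1/2"
    unfolding eventually_nhds_metric by blast
  define B where "B = ball x0 r"
  define U where "U = torus_proj ` B"
  have B: "open B" "x0 \<in> B" unfolding B_def using r by auto
  have near: "y = z" if "y \<in> B" "z \<in> B" "torus_map (torus_proj y) = torus_map (torus_proj z)" for y z
  proof -
    have "same_mod_lattice (lifted_map y) (lifted_map z)"
      using that(3) by (simp add: torus_proj_eq_iff)
    moreover have "dist (lifted_map y) (lifted_map z) < 1"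
      by (rule dist_triangle_half_l[of _ "lifted_map x0"])
        (use r(2)[of y] r(2)[of z] that in \<open>simp_all add: B_def dist_commute\<close>)
    ultimately have "lifted_map y = lifted_map z"
      by (intro same_mod_lattice_near_eq) (simp_all add: dist_norm)
    then show ?thesis by (metis lifted_inverse(1))
  qed
  have inj: "inj_on torus_map U"
    unfolding U_def by (rule inj_onI) (use near in blast)
  define g where "g = inv_into U torus_map"
  have g: "g (torus_map q) = q" if "q \<in> U" for q
    unfolding g_def using inj that by (rule inv_into_f_f)
  have img: "torus_map ` U = torus_proj ` (lifted_inverse -` B)"
  proof -
    have "lifted_map ` B = lifted_inverse -` B" by (auto intro: image_eqI[of _ _ "lifted_inverse _"])
    then show ?thesis unfolding U_def by (metis (no_types, lifting) image_cong image_image torus_map.abs_eq)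
  qed
  have open_pre: "open (lifted_inverse -` B)"
    using B(1) isCont_lifted_inverse by (intro open_vimage continuous_at_imp_continuous_on) auto
  have lift_g: "g (torus_proj z) = torus_proj (lifted_inverse z)" if "lifted_inverse z \<in> B" for z
    using g[of "torus_proj (lifted_inverse z)"] that by (simp add: U_def)
  \<comment> \<open>The inverse of the Jacobian, evaluated at the preimage.\<close>
  define D where "D q = (let s = slope_at (g q) in mat2 (1 / s) 0 (- 1 / (2 * s)) (1 / 2) :: real^2^2)" for q
  have "torus_C1_on (torus_map ` U) g"
    unfolding torus_C1_on_def
  proof (intro exI[of _ D] conjI ballI continuous_on_torusI)
    fix q assume "q \<in> torus_map ` U"
    then obtain y where y: "y \<in> B" "q = torus_proj (lifted_map y)" unfolding U_def by auto
    have near: "\<forall>\<^sub>F z in nhds (lifted_map y). lifted_inverse z \<in> B"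
      using eventually_nhds_in_open[OF open_pre, of "lifted_map y"] y by simp
    show "torus_has_deriv g (D q) q"
      unfolding torus_has_deriv_def
    proof (intro exI conjI)
      show "torus_proj (lifted_map y) = q" using y by simp
      show "\<forall>\<^sub>F z in nhds (lifted_map y). torus_proj (lifted_inverse z) = g (torus_proj z)"
        using near by eventually_elim (simp add: lift_g)
      show "(lifted_inverse has_derivative (*v) (D q)) (at (lifted_map y))"
        using lifted_inverse_deriv[of y] y lift_g[of "lifted_map y"] by (simp add: D_def Let_def)
    qed
    let ?s = "\<lambda>z. slope (lifted_inverse z $ 1)"
    have "isCont ?s (lifted_map y)"
      by (rule isCont_o2[OF isCont_o2[OF isCont_lifted_inverse isCont_nth] isCont_slope])
    moreover have "?s (lifted_map y) \<noteq> 0" using slope_pos by (metis less_irrefl)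
    ultimately have "isCont (\<lambda>z. mat2 (1 / ?s z) 0 (- 1 / (2 * ?s z)) (1 / 2) :: real^2^2) (lifted_map y)"
      by (intro continuous_intros) auto
    moreover have "\<forall>\<^sub>F z in nhds (lifted_map y).
        D (torus_proj z) = mat2 (1 / ?s z) 0 (- 1 / (2 * ?s z)) (1 / 2)"
      using near by eventually_elim (simp add: lift_g D_def Let_def)
    ultimately have "isCont (\<lambda>z. D (torus_proj z)) (lifted_map y)"
      using isCont_cong by fast
    then show "\<exists>x. torus_proj x = q \<and> isCont (\<lambda>z. D (torus_proj z)) x" using y by blast
  qed
  then show "\<exists>U g. open U \<and> p \<in> U \<and> open (torus_map ` U) \<and> torus_C1_on U torus_map \<and>
      torus_C1_on (torus_map ` U) g \<and> (\<forall>q\<in>U. g (torus_map q) = q)"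
    using B open_image_torus_proj[OF B(1)] open_image_torus_proj[OF open_pre] img g torus_C1_torus_map
    by (intro exI[of _ U] exI[of _ g]) (auto simp: U_def p)
qed

section \<open>Homotopy to a linear expanding map\<close>

definition linear_part :: "int^2^2" where
  "linear_part = mat2 2 0 1 2"

lemma map_matrix_linear_part: "map_matrix of_int linear_part = (mat2 2 0 1 2 :: 'a::ring_1^2^2)"
  by (simp add: linear_part_def map_matrix_def vec_eq_iff forall_2)

lemma expanding_linear_part: "expanding_linear_map (toral_linear_map linear_part)"
  unfolding expanding_linear_map_def
proof (intro exI conjI)
  show "det linear_part \<noteq> 0" by (simp add: det_2 linear_part_def)
  show "expanding_matrix linear_part"
    unfolding expanding_matrix_def map_matrix_linear_part
  proof (intro allI impI)
    fix \<mu> :: complex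
    assume "\<exists>v. v \<noteq> 0 \<and> mat2 2 0 1 2 *v v = \<mu> *s v"
    then obtain v where v: "v \<noteq> 0" "mat2 2 0 1 2 *v v = \<mu> *s v" by blast
    have "2 * v $ 1 = \<mu> * v $ 1" "v $ 1 + 2 * v $ 2 = \<mu> * v $ 2"
      using arg_cong[OF v(2), of "\<lambda>u. u $ 1"] arg_cong[OF v(2), of "\<lambda>u. u $ 2"]
      by (simp_all add: matrix_vector_mult_def sum_2)
    moreover have "v $ 1 \<noteq> 0 \<or> v $ 2 \<noteq> 0" using v(1) by (auto simp: vec_eq_iff forall_2)
    ultimately have "\<mu> = 2" by (cases "v $ 1 = 0") auto
    then show "cmod \<mu> > 1" by simp
  qed
qed simp

text \<open>
  The sine term is periodic, so it can be damped without losing equivariance.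
\<close>

lift_definition homotopy_map :: "real \<Rightarrow> torus \<Rightarrow> torus" is
  "\<lambda>s v. pt (2 * v $ 1 - s * (9 / (10 * pi) * sin (2 * pi * v $ 1))) (v $ 1 + 2 * v $ 2)"
proof -
  fix s and x y :: "real^2"
  assume *: "same_mod_lattice x y"
  then obtain k where k: "x $ 1 = y $ 1 + of_int k"
    unfolding same_mod_lattice_iff using eq_add_int_if_diff_Ints by blast
  have "(x $ 1 - y $ 1) + (x $ 2 - y $ 2) + (x $ 2 - y $ 2) \<in> \<int>"
    using * unfolding same_mod_lattice_iff by (intro Ints_add) auto
  then show "same_mod_lattice
      (pt (2 * x $ 1 - s * (9 / (10 * pi) * sin (2 * pi * x $ 1))) (x $ 1 + 2 * x $ 2))
      (pt (2 * y $ 1 - s * (9 / (10 * pi) * sin (2 * pi * y $ 1))) (y $ 1 + 2 * y $ 2))"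
    unfolding same_mod_lattice_iff pt_nth k sin_periodic_int by (simp add: algebra_simps)
qed

lemma torus_map_homotopic:
  "homotopic_with_canon (\<lambda>_. True) UNIV UNIV torus_map (toral_linear_map linear_part)"
proof -
  let ?H = "\<lambda>(s, v). pt (2 * v $ 1 - s * (9 / (10 * pi) * sin (2 * pi * v $ 1))) (v $ 1 + 2 * v $ 2)"
  have cont: "continuous_on UNIV (\<lambda>(s, p). homotopy_map s p)"
    unfolding continuous_on_def
  proof
    fix sp :: "real \<times> torus"
    obtain s x where sp: "sp = (s, torus_proj x)" by (metis surj_pair torus_cases)
    have "nhds sp = filtermap (apsnd torus_proj) (nhds (s, x))"
      unfolding sp nhds_prod nhds_torus_proj prod_filtermap2 ..
    moreover have "((\<lambda>sv. (\<lambda>(s, p). homotopy_map s p) (apsnd torus_proj sv)) \<longlongrightarrow>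
        (\<lambda>(s, p). homotopy_map s p) sp) (nhds (s, x))"
    proof -
      have "isCont ?H (s, x)"
        unfolding case_prod_beta by (intro continuous_intros continuous_fst continuous_snd)
      from isCont_o2[OF this isCont_torus_proj] have "isCont (\<lambda>sv. torus_proj (?H sv)) (s, x)" .
      then show ?thesis
        unfolding isCont_iff_tendsto_nhds by (simp add: sp case_prod_beta homotopy_map.abs_eq)
    qed
    ultimately have "((\<lambda>(s, p). homotopy_map s p) \<longlongrightarrow> (\<lambda>(s, p). homotopy_map s p) sp) (nhds sp)"
      by (simp add: filterlim_filtermap)
    then show "((\<lambda>(s, p). homotopy_map s p) \<longlongrightarrow> (\<lambda>(s, p). homotopy_map s p) sp) (at sp within UNIV)"
      by (rule tendsto_mono[OF at_within_le_nhds])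
  qed
  have "homotopy_map 0 p = toral_linear_map linear_part p \<and> homotopy_map 1 p = torus_map p" for p
  proof -
    obtain x where p: "p = torus_proj x" by (rule torus_cases)
    show ?thesis
      by (simp add: p homotopy_map.abs_eq toral_linear_map.abs_eq map_matrix_linear_part mat2_mult_vec
          lifted_map_def base_map_def)
  qed
  then have "homotopic_with_canon (\<lambda>_. True) UNIV UNIV (toral_linear_map linear_part) torus_map"
    unfolding homotopic_with_def prod_topology_subtopology_eu
    by (intro exI[of _ "\<lambda>(s, p). homotopy_map s p"] conjI)
      (auto intro: continuous_on_subset[OF cont])
  then show ?thesis by (rule homotopic_with_symD)
qed

section \<open>Partial hyperbolicity\<close>

lemma tilt_at_nonneg: "0 \<le> tilt_at p" and tilt_at_less_2: "tilt_at p < 2"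
proof -
  obtain x where "p = torus_proj x" by (rule torus_cases)
  then show "0 \<le> tilt_at p" "tilt_at p < 2" by (simp_all add: tilt_nonneg tilt_less_2)
qed

text \<open>
  The functional that annihilates the centre direction.
\<close>

definition transverse :: "torus \<Rightarrow> real^2 \<Rightarrow> real" where
  "transverse p v = v $ 1 + tilt_at p * v $ 2"

definition centre_vector :: "torus \<Rightarrow> real^2" where
  "centre_vector p = pt (tilt_at p) (-1)"

definition centre_field :: "torus \<Rightarrow> (real^2) set" where
  "centre_field p = span {centre_vector p}"

definition expansion_at :: "torus \<Rightarrow> real" where
  "expansion_at p = slope_at p + tilt_at (torus_map p)"

lemma expansion_at_proj: "expansion_at (torus_proj x) = expansion (x $ 1)"
  by (simp add: expansion_at_def expansion_def lifted_map_def)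

lemma expansion_at_ge_2: "expansion_at p \<ge> 2"
proof -
  obtain x where "p = torus_proj x" by (rule torus_cases)
  then show ?thesis by (simp add: expansion_at_proj expansion_ge_2)
qed

lemma tilt_at_step: "tilt_at p * (tilt_at (torus_map p) + slope_at p) = 2 * tilt_at (torus_map p)"
proof -
  obtain x where "p = torus_proj x" by (rule torus_cases)
  then show ?thesis using tilt_step[of "x $ 1"] by (simp add: lifted_map_def)
qed

lemma transverse_map_jacobian: "transverse (torus_map p) (map_jacobian p *v v) = expansion_at p * transverse p v"
proof -
  have "expansion_at p * transverse p v = (slope_at p + tilt_at (torus_map p)) * v $ 1
      + tilt_at p * (tilt_at (torus_map p) + slope_at p) * v $ 2"
    by (simp add: expansion_at_def transverse_def algebra_simps)
  also have "\<dots> = transverse (torus_map p) (map_jacobian p *v v)"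
    unfolding tilt_at_step by (simp add: map_jacobian_def transverse_def mat2_mult_vec algebra_simps)
  finally show ?thesis ..
qed

lemma vertical_map_jacobian: "(map_jacobian p *v v) $ 2 = transverse p v + (2 - tilt_at p) * v $ 2"
  by (simp add: map_jacobian_def transverse_def mat2_mult_vec algebra_simps)

lemma centre_vector_map_jacobian:
  "map_jacobian p *v centre_vector p = (2 - tilt_at p) *\<^sub>R centre_vector (torus_map p)"
  using tilt_at_step[of p] by (simp add: map_jacobian_def centre_vector_def mat2_mult_vec pt_eq_iff algebra_simps)

text \<open>
  For large \<open>R\<close> this cone contains every direction except those close to the centre direction.
\<close>

definition wide_cone :: "real \<Rightarrow> torus \<Rightarrow> (real^2) set" where
  "wide_cone R p = {v. \<bar>v $ 2\<bar> \<le> R * \<bar>transverse p v\<bar>}"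

definition cone_form :: "real \<Rightarrow> torus \<Rightarrow> real^2^2" where
  "cone_form R p = mat2 (R^2) (R^2 * tilt_at p) (R^2 * tilt_at p) (R^2 * (tilt_at p)^2 - 1)"

lemma cone_form_eq: "v \<bullet> (cone_form R p *v v) = (R * transverse p v)^2 - (v $ 2)^2"
  by (simp add: inner_vec_def sum_2 cone_form_def transverse_def mat2_mult_vec power2_eq_square algebra_simps)

lemma cone_family_cone:
  assumes "R > 0" shows "cone_family (wide_cone R)"
  unfolding cone_family_def
proof (intro exI[of _ "cone_form R"] conjI allI)
  show "continuous_on UNIV (cone_form R)"
  proof (rule continuous_on_torusI)
    fix p obtain x where p: "p = torus_proj x" by (rule torus_cases)
    have "isCont (\<lambda>y. cone_form R (torus_proj y)) x"
      unfolding cone_form_def tilt_at.abs_eq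
      by (intro continuous_intros isCont_o2[OF isCont_nth isCont_tilt])
    then show "\<exists>x. torus_proj x = p \<and> isCont (\<lambda>y. cone_form R (torus_proj y)) x" using p by blast
  qed
  fix p
  show "transpose (cone_form R p) = cone_form R p"
    by (simp add: transpose_def vec_eq_iff forall_2 cone_form_def)
  have "det (cone_form R p) = - (R^2)"
    by (simp add: det_2 cone_form_def power2_eq_square algebra_simps)
  then show "invertible (cone_form R p)" using assms by (simp add: invertible_det_nz)
  show "\<exists>v. v \<bullet> (cone_form R p *v v) > 0"
    unfolding cone_form_eq by (rule exI[of _ "pt 1 0"]) (use assms in \<open>simp add: transverse_def\<close>)
  \<comment> \<open>The centre vector is the natural direction outside the cone.\<close>
  show "\<exists>v. v \<bullet> (cone_form R p *v v) < 0"
    unfolding cone_form_eq by (rule exI[of _ "centre_vector p"]) (simp add: transverse_def centre_vector_def)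
  show "wide_cone R p = {v. v \<bullet> (cone_form R p *v v) \<ge> 0}"
  proof -
    have "\<bar>v $ 2\<bar> \<le> R * \<bar>transverse p v\<bar> \<longleftrightarrow> \<bar>v $ 2\<bar> \<le> \<bar>R * transverse p v\<bar>" for v
      using assms by (simp add: abs_mult)
    then show ?thesis unfolding wide_cone_def cone_form_eq by (simp add: abs_le_square_iff)
  qed
qed

lemma open_cone_interior: "open {v. \<bar>v $ 2\<bar> < R * \<bar>transverse p v\<bar>}"
  unfolding transverse_def by (intro open_Collect_less continuous_intros)

lemma uniform_cone_constant:
  obtains R where "R > 0" "\<And>p. R * (expansion_at p - (2 - tilt_at p)) > 1"
proof -
  obtain \<delta> where \<delta>: "\<delta> > 0" "\<And>x. expansion x - (2 - tilt x) \<ge> \<delta>" by (rule domination_uniform) blast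
  show ?thesis
  \<comment> \<open>Any constant greater than \<open>1 / \<delta>\<close> would do.\<close>
  proof (rule that[of "2 / \<delta>"])
    fix p obtain x where p: "p = torus_proj x" by (rule torus_cases)
    have "2 = 2 / \<delta> * \<delta>" using \<delta>(1) by simp
    also have "2 / \<delta> * \<delta> \<le> 2 / \<delta> * (expansion_at p - (2 - tilt_at p))"
      using \<delta> by (intro mult_left_mono) (simp_all add: p expansion_at_proj)
    finally show "2 / \<delta> * (expansion_at p - (2 - tilt_at p)) > 1" by linarith
  qed (use \<delta> in simp)
qed

text \<open>
  With \<open>\<tau> = transverse p v\<close>, the derivative multiplies \<open>\<tau>\<close> by \<open>m = expansion_at p\<close> and sends \<open>v $ 2\<close>
  to \<open>\<tau> + c * v $ 2\<close> with \<open>c = 2 - tilt_at p\<close>.  On the cone the new second coordinate is thus at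
  most \<open>(1 + c * R) * \<bar>\<tau>\<bar>\<close>, which is less than \<open>R * m * \<bar>\<tau>\<bar>\<close> by the choice of \<open>R\<close>.
\<close>

lemma cone_strictly_invariant:
  assumes "R > 0" "R * (expansion_at p - (2 - tilt_at p)) > 1" "v \<in> wide_cone R p" "v \<noteq> 0"
  shows "map_jacobian p *v v \<in> interior (wide_cone R (torus_map p))"
proof -
  let ?\<tau> = "transverse p v" and ?u = "map_jacobian p *v v"
  have v2: "\<bar>v $ 2\<bar> \<le> R * \<bar>?\<tau>\<bar>" using assms(3) by (simp add: wide_cone_def)
  have "?\<tau> \<noteq> 0"
  proof
    assume 0: "?\<tau> = 0"
    then have "v $ 2 = 0" using v2 by simp
    with 0 have "v $ 1 = 0" by (simp add: transverse_def)
    with \<open>v $ 2 = 0\<close> \<open>v \<noteq> 0\<close> show False by (simp add: pt_eq_iff)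
  qed
  have c: "0 \<le> 2 - tilt_at p" using tilt_at_less_2[of p] by simp
  have "\<bar>?u $ 2\<bar> \<le> \<bar>?\<tau>\<bar> + \<bar>(2 - tilt_at p) * v $ 2\<bar>"
    unfolding vertical_map_jacobian by (rule abs_triangle_ineq)
  also have "\<dots> = \<bar>?\<tau>\<bar> + (2 - tilt_at p) * \<bar>v $ 2\<bar>" using c by (simp add: abs_mult)
  also have "\<dots> \<le> \<bar>?\<tau>\<bar> + (2 - tilt_at p) * (R * \<bar>?\<tau>\<bar>)"
    using c v2 by (intro add_left_mono mult_left_mono)
  also have "\<dots> = (1 + R * (2 - tilt_at p)) * \<bar>?\<tau>\<bar>" by (simp add: algebra_simps)
  also have "\<dots> < (R * expansion_at p) * \<bar>?\<tau>\<bar>"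
    using assms(2) \<open>?\<tau> \<noteq> 0\<close> by (intro mult_strict_right_mono) (simp_all add: right_diff_distrib)
  also have "\<dots> = R * \<bar>transverse (torus_map p) ?u\<bar>"
    unfolding transverse_map_jacobian using expansion_at_ge_2[of p] by (simp add: abs_mult)
  finally have "?u \<in> {v. \<bar>v $ 2\<bar> < R * \<bar>transverse (torus_map p) v\<bar>}" by simp
  then show ?thesis
    by (rule interiorI[OF open_cone_interior]) (auto simp: wide_cone_def)
qed

lemma invariant_cone:
  assumes "R > 0" "\<And>p. R * (expansion_at p - (2 - tilt_at p)) > 1"
  shows "invariant_cone_family torus_map (wide_cone R)"
  unfolding invariant_cone_family_def torus_deriv_torus_map
proof (intro conjI allI cone_family_cone assms subsetI)
  fix p u assume "u \<in> (*v) (map_jacobian p) ` wide_cone R p"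
  then obtain v where v: "v \<in> wide_cone R p" "u = map_jacobian p *v v" by auto
  show "u \<in> insert 0 (interior (wide_cone R (torus_map p)))"
  proof (cases "v = 0")
    case True
    then show ?thesis using v by simp
  next
    case False
    then show ?thesis using cone_strictly_invariant[OF assms(1) assms(2) v(1)] v by simp
  qed
qed

lemma torus_map_iterate_deriv:
  "\<exists>D. torus_has_deriv (torus_map ^^ k) D p \<and>
     (\<forall>v. \<bar>transverse ((torus_map ^^ k) p) (D *v v)\<bar> \<ge> 2 ^ k * \<bar>transverse p v\<bar>)"
proof -
  obtain x where p: "p = torus_proj x" by (rule torus_cases)
  have proj: "torus_proj ((lifted_map ^^ k) y) = (torus_map ^^ k) (torus_proj y)" for k y
    by (induction k) (simp_all flip: torus_map.abs_eq)
  have "\<exists>D. ((lifted_map ^^ k) has_derivative (\<lambda>v. D *v v)) (at x) \<and>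
     (\<forall>v. \<bar>transverse ((torus_map ^^ k) p) (D *v v)\<bar> \<ge> 2 ^ k * \<bar>transverse p v\<bar>)"
  proof (induction k)
    case 0
    show ?case by (intro exI[of _ "mat 1"]) (auto simp: id_def intro!: derivative_eq_intros)
  next
    case (Suc k)
    let ?y = "(lifted_map ^^ k) x" and ?q = "(torus_map ^^ k) p"
    obtain D where D: "((lifted_map ^^ k) has_derivative (\<lambda>v. D *v v)) (at x)"
      "\<And>v. \<bar>transverse ?q (D *v v)\<bar> \<ge> 2 ^ k * \<bar>transverse p v\<bar>" using Suc by blast
    have q: "?q = torus_proj ?y" by (simp add: proj p)
    have "((\<lambda>y. lifted_map ((lifted_map ^^ k) y)) has_derivative
        (\<lambda>v. mat2 (slope (?y $ 1)) 0 1 2 *v (D *v v))) (at x)"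
      by (rule has_derivative_compose[OF D(1) lifted_map_deriv])
    then have "((lifted_map ^^ Suc k) has_derivative (\<lambda>v. (map_jacobian ?q ** D) *v v)) (at x)"
      by (simp add: q map_jacobian_def comp_def matrix_vector_mul_assoc)
    moreover have "2 ^ Suc k * \<bar>transverse p v\<bar> \<le> \<bar>transverse ((torus_map ^^ Suc k) p) ((map_jacobian ?q ** D) *v v)\<bar>" for v
    proof -
      have "2 * (2 ^ k * \<bar>transverse p v\<bar>) \<le> expansion_at ?q * \<bar>transverse ?q (D *v v)\<bar>"
        using expansion_at_ge_2[of ?q] D(2)[of v] by (intro mult_mono) auto
      also have "\<dots> = \<bar>expansion_at ?q * transverse ?q (D *v v)\<bar>"
        using expansion_at_ge_2[of ?q] by (simp add: abs_mult)
      finally show ?thesis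
        by (simp add: transverse_map_jacobian matrix_vector_mul_assoc[symmetric] mult.assoc)
    qed
    ultimately show ?case by blast
  qed
  then obtain D where D: "((lifted_map ^^ k) has_derivative (\<lambda>v. D *v v)) (at x)"
    "\<And>v. \<bar>transverse ((torus_map ^^ k) p) (D *v v)\<bar> \<ge> 2 ^ k * \<bar>transverse p v\<bar>" by blast
  have "torus_has_deriv (torus_map ^^ k) D p"
    unfolding p by (rule torus_has_deriv_lift[OF proj D(1)])
  with D(2) show ?thesis by blast
qed

lemma transverse_le_norm: "\<bar>transverse p v\<bar> \<le> 3 * norm v"
proof -
  have "\<bar>transverse p v\<bar> \<le> \<bar>v $ 1\<bar> + tilt_at p * \<bar>v $ 2\<bar>"
    unfolding transverse_def using tilt_at_nonneg[of p]
    by (intro order_trans[OF abs_triangle_ineq]) (simp add: abs_mult)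
  also have "\<dots> \<le> norm v + 2 * norm v"
    using tilt_at_nonneg[of p] tilt_at_less_2[of p]
    by (intro add_mono mult_mono component_le_norm_cart) auto
  finally show ?thesis by simp
qed

lemma norm_le_transverse:
  assumes "v \<in> wide_cone R p" "R > 0"
  shows "norm v \<le> (1 + 3 * R) * \<bar>transverse p v\<bar>"
proof -
  have v2: "\<bar>v $ 2\<bar> \<le> R * \<bar>transverse p v\<bar>" using assms by (simp add: wide_cone_def)
  have "norm v \<le> \<bar>v $ 1\<bar> + \<bar>v $ 2\<bar>" using norm_le_l1_cart[of v] by (simp add: sum_2)
  also have "\<bar>v $ 1\<bar> \<le> \<bar>transverse p v\<bar> + tilt_at p * \<bar>v $ 2\<bar>"
  proof -
    have "v $ 1 = transverse p v - tilt_at p * v $ 2" by (simp add: transverse_def)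
    then have "\<bar>v $ 1\<bar> \<le> \<bar>transverse p v\<bar> + \<bar>tilt_at p * v $ 2\<bar>" by linarith
    then show ?thesis using tilt_at_nonneg[of p] by (simp add: abs_mult)
  qed
  also have "tilt_at p * \<bar>v $ 2\<bar> \<le> 2 * \<bar>v $ 2\<bar>"
    using tilt_at_less_2[of p] by (intro mult_right_mono) auto
  finally show ?thesis using v2 by (simp add: algebra_simps)
qed

text \<open>
  On the cone the norm is comparable to \<open>\<bar>transverse p v\<bar>\<close>, which at least doubles at every step.
  The constant lost in the comparison is beaten by taking enough iterates.
\<close>

lemma unstable_cone:
  assumes "R > 0" "\<And>p. R * (expansion_at p - (2 - tilt_at p)) > 1"
  shows "unstable_cone_family torus_map (wide_cone R)"
  unfolding unstable_cone_family_def
proof (intro conjI invariant_cone assms)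
  \<comment> \<open>The factors \<open>3\<close> and \<open>1 + 3 * R\<close> are lost in the two comparisons of the norm with \<open>transverse\<close>.\<close>
  obtain k :: nat where k: "3 * (1 + 3 * R) < 2 ^ k" using real_arch_pow[of 2 "3 * (1 + 3 * R)"] by auto
  have "k > 0"
  proof (rule ccontr)
    assume "\<not> k > 0"
    then show False using k assms(1) by simp
  qed
  show "\<exists>k>0. \<forall>p. \<forall>v\<in>wide_cone R p. norm v = 1 \<longrightarrow> norm (torus_deriv (torus_map ^^ k) p *v v) > 1"
  proof (intro exI[of _ k] conjI allI ballI impI)
    fix p v assume v: "v \<in> wide_cone R p" "norm v = 1"
    obtain D where D: "torus_has_deriv (torus_map ^^ k) D p"
      "\<bar>transverse ((torus_map ^^ k) p) (D *v v)\<bar> \<ge> 2 ^ k * \<bar>transverse p v\<bar>"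
      using torus_map_iterate_deriv by blast
    have \<tau>: "1 \<le> (1 + 3 * R) * \<bar>transverse p v\<bar>" using norm_le_transverse[OF v(1) assms(1)] v(2) by simp
    then have "\<bar>transverse p v\<bar> > 0" using assms(1) by (cases "transverse p v = 0") auto
    have "3 * 1 \<le> 3 * (1 + 3 * R) * \<bar>transverse p v\<bar>"
      unfolding mult.assoc using \<tau> by (intro mult_left_mono) auto
    also have "\<dots> < 2 ^ k * \<bar>transverse p v\<bar>"
      using k \<open>\<bar>transverse p v\<bar> > 0\<close> by (intro mult_strict_right_mono)
    also have "\<dots> \<le> 3 * norm (D *v v)" using D(2) transverse_le_norm by (rule order_trans)
    finally show "norm (torus_deriv (torus_map ^^ k) p *v v) > 1"
      using torus_deriv_eqI[OF D(1)] by simp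
  qed (rule \<open>k > 0\<close>)
qed

lemma partially_hyperbolic_torus_map: "partially_hyperbolic torus_map"
  unfolding partially_hyperbolic_def
  using torus_map_local_diffeo uniform_cone_constant unstable_cone by metis

lemma mem_centre_field_iff: "v \<in> centre_field p \<longleftrightarrow> (\<exists>s. v = s *\<^sub>R centre_vector p)"
  unfolding centre_field_def span_singleton by auto

lemma centre_direction_torus_map: "centre_direction torus_map centre_field"
  unfolding centre_direction_def
proof (intro conjI allI)
  have "continuous_on UNIV centre_vector"
  proof (rule continuous_on_torusI)
    fix p obtain x where p: "p = torus_proj x" by (rule torus_cases)
    have "isCont (\<lambda>y. centre_vector (torus_proj y)) x"
      unfolding centre_vector_def tilt_at.abs_eq
      by (intro continuous_intros isCont_o2[OF isCont_nth isCont_tilt])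
    then show "\<exists>x. torus_proj x = p \<and> isCont (\<lambda>y. centre_vector (torus_proj y)) x" using p by blast
  qed
  moreover have "centre_vector p \<noteq> 0" for p by (simp add: pt_eq_iff centre_vector_def)
  ultimately show "continuous_line_field centre_field"
    unfolding continuous_line_field_def centre_field_def
    by (intro allI exI[of _ UNIV] exI[of _ centre_vector]) simp
next
  fix p
  have c: "2 - tilt_at p \<noteq> 0" using tilt_at_less_2[of p] by simp
  show "(\<lambda>v. torus_deriv torus_map p *v v) ` centre_field p = centre_field (torus_map p)"
  proof (intro set_eqI iffI)
    fix u assume "u \<in> (\<lambda>v. torus_deriv torus_map p *v v) ` centre_field p"
    then obtain s where "u = map_jacobian p *v (s *\<^sub>R centre_vector p)"
      by (auto simp: torus_deriv_torus_map mem_centre_field_iff)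
    then have "u = (s * (2 - tilt_at p)) *\<^sub>R centre_vector (torus_map p)"
      by (simp add: matrix_vector_mult_scaleR centre_vector_map_jacobian)
    then show "u \<in> centre_field (torus_map p)" unfolding mem_centre_field_iff by blast
  next
    fix u assume "u \<in> centre_field (torus_map p)"
    then obtain s where "u = s *\<^sub>R centre_vector (torus_map p)" unfolding mem_centre_field_iff by blast
    then have "u = map_jacobian p *v ((s / (2 - tilt_at p)) *\<^sub>R centre_vector p)"
      using c by (simp add: matrix_vector_mult_scaleR centre_vector_map_jacobian)
    then show "u \<in> (\<lambda>v. torus_deriv torus_map p *v v) ` centre_field p"
      unfolding torus_deriv_torus_map using mem_centre_field_iff by blast
  qed
next
  obtain R where R: "R > 0" "\<And>p. R * (expansion_at p - (2 - tilt_at p)) > 1"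
    by (rule uniform_cone_constant) blast
  have "centre_field p \<inter> wide_cone R p = {0}" for p
  proof (intro set_eqI iffI)
    fix v assume "v \<in> centre_field p \<inter> wide_cone R p"
    then obtain s where "v = s *\<^sub>R centre_vector p" "\<bar>v $ 2\<bar> \<le> R * \<bar>transverse p v\<bar>"
      unfolding Int_iff mem_centre_field_iff wide_cone_def by blast
    then show "v \<in> {0}" by (simp add: centre_vector_def transverse_def)
  next
    fix v :: "real^2" assume "v \<in> {0}"
    then show "v \<in> centre_field p \<inter> wide_cone R p"
      by (simp add: centre_field_def span_zero wide_cone_def transverse_def)
  qed
  then show "\<exists>C. unstable_cone_family torus_map C \<and> (\<forall>p. centre_field p \<inter> C p = {0})"
    using unstable_cone[OF R] by blast
qed

section \<open>Unique integrability over the basin\<close>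

lemma local_inverse_real:
  fixes f f' :: "real \<Rightarrow> real"
  assumes "e > 0" and deriv: "\<And>t. t \<in> {-e<..<e} \<Longrightarrow> (f has_real_derivative f' t) (at t)"
    and nz: "\<And>t. t \<in> {-e<..<e} \<Longrightarrow> f' t \<noteq> 0"
  obtains r g where "r > 0" "g (f 0) = 0"
    "\<And>y. y \<in> ball (f 0) r \<Longrightarrow> g y \<in> {-e<..<e} \<and> f (g y) = y"
    "\<And>y. y \<in> ball (f 0) r \<Longrightarrow> (g has_real_derivative 1 / f' (g y)) (at y)"
proof -
  let ?S = "{-e<..<e}"
  have cont: "continuous_on ?S f"
    using deriv DERIV_isCont by (blast intro: continuous_at_imp_continuous_on)
  have ne: "f s \<noteq> f t" if "s \<in> ?S" "t \<in> ?S" "s < t" for s t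
  proof -
    have "(f has_real_derivative f' x) (at x)" if "s \<le> x" "x \<le> t" for x
      using \<open>s \<in> ?S\<close> \<open>t \<in> ?S\<close> that by (intro deriv) auto
    then obtain z where z: "z > s" "z < t" "f t - f s = (t - s) * f' z"
      using MVT2[OF \<open>s < t\<close>, of f f'] by blast
    then have "z \<in> ?S" using that by auto
    with z nz[of z] that show ?thesis by auto
  qed
  have inj: "inj_on f ?S"
  proof (rule inj_onI)
    fix s t assume "s \<in> ?S" "t \<in> ?S" "f s = f t"
    then show "s = t" using ne[of s t] ne[of t s] by (cases s t rule: linorder_cases) auto
  qed
  have "open (f ` ?S)" using cont inj by (intro invariance_of_domain) auto
  moreover have "f 0 \<in> f ` ?S" using \<open>e > 0\<close> by auto
  ultimately obtain r where r: "r > 0" "ball (f 0) r \<subseteq> f ` ?S" using openE by blast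
  define g where "g = inv_into ?S f"
  have gf: "g (f t) = t" if "t \<in> ?S" for t unfolding g_def using inj that by (rule inv_into_f_f)
  have g: "g y \<in> ?S \<and> f (g y) = y" if "y \<in> ball (f 0) r" for y
    using r(2) that gf by fastforce
  show ?thesis
  proof (rule that[of r g])
    show "r > 0" "g (f 0) = 0" using r gf \<open>e > 0\<close> by auto
    show "g y \<in> ?S \<and> f (g y) = y" if "y \<in> ball (f 0) r" for y using g that .
    show "(g has_real_derivative 1 / f' (g y)) (at y)" if "y \<in> ball (f 0) r" for y
    proof -
      have "(g has_real_derivative 1 / f' (g y)) (at (f (g y)))"
        by (rule DERIV_local_inverse[where S = ?S]) (use g[OF that] cont gf deriv nz in auto)
      then show ?thesis using g[OF that] by simp
    qed
  qed
qed

lemma local_primitive: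
  assumes "x \<in> basin"
  obtains l u W where "l < x" "x < u" "{l<..<u} \<subseteq> basin"
    "\<And>z. z \<in> {l<..<u} \<Longrightarrow> (W has_real_derivative 1 / tilt z) (at z)"
proof -
  obtain r where r: "r > 0" "cball x r \<subseteq> basin"
    using open_basin assms open_contains_cball by blast
  have sub: "{x - r..x + r} \<subseteq> basin" using r(2) by (simp add: cball_eq_atLeastAtMost)
  have nz: "tilt z \<noteq> 0" if "z \<in> {x - r..x + r}" for z
    using tilt_pos[of z] sub that by force
  have "continuous_on {x - r..x + r} (\<lambda>z. 1 / tilt z)"
    using nz by (intro continuous_intros continuous_tilt) blast
  then obtain W where W: "\<And>z. z \<in> {x - r..x + r} \<Longrightarrow>
      (W has_vector_derivative 1 / tilt z) (at z within {x - r..x + r})"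
    by (rule antiderivative_continuous) blast
  show ?thesis
  proof (rule that[of "x - r" "x + r" W])
    show "{x - r<..<x + r} \<subseteq> basin" using sub by auto
    fix z assume z: "z \<in> {x - r<..<x + r}"
    then have "at z within {x - r..x + r} = at z"
      by (intro at_within_interior) simp
    then show "(W has_real_derivative 1 / tilt z) (at z)"
      using W[of z] z by (auto simp: has_real_derivative_iff_has_vector_derivative)
  qed (use r in auto)
qed

text \<open>
  Over the basin the centre direction has the finite slope \<open>- 1 / tilt\<close>, so \<open>y + W x\<close> has zero
  derivative along a tangent curve, and the horizontal velocity \<open>\<sigma>\<close> does not vanish.
\<close>

lemma tangent_curve_first_integral:
  assumes curve: "tangent_curve centre_field (torus_proj x0) I \<gamma>"
    and x0: "x0 $ 1 \<in> {l<..<u}" and basin: "{l<..<u} \<subseteq> basin"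
    and W: "\<And>z. z \<in> {l<..<u} \<Longrightarrow> (W has_real_derivative 1 / tilt z) (at z)"
  obtains e c \<sigma> where "e > 0" "{-e<..<e} \<subseteq> I" "c 0 = x0"
    "\<And>t. t \<in> {-e<..<e} \<Longrightarrow> torus_proj (c t) = \<gamma> t"
    "\<And>t. t \<in> {-e<..<e} \<Longrightarrow> ((\<lambda>t. c t $ 1) has_real_derivative \<sigma> t) (at t)"
    "continuous_on {-e<..<e} \<sigma>" "\<And>t. t \<in> {-e<..<e} \<Longrightarrow> \<sigma> t \<noteq> 0"
    "\<And>t. t \<in> {-e<..<e} \<Longrightarrow> c t $ 2 + W (c t $ 1) = x0 $ 2 + W (x0 $ 1)"
proof -
  obtain \<gamma>' where I: "open I" "0 \<in> I" "\<gamma> 0 = torus_proj x0" "continuous_on I \<gamma>'"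
    and vel: "\<And>t. t \<in> I \<Longrightarrow> curve_has_velocity \<gamma> (\<gamma>' t) t"
    and tang: "\<And>t. t \<in> I \<Longrightarrow> \<gamma>' t \<noteq> 0 \<and> \<gamma>' t \<in> centre_field (\<gamma> t)"
    using curve unfolding tangent_curve_def by blast
  obtain d c where d: "d > 0" "{-d<..<d} \<subseteq> I" "c 0 = x0"
    and c: "\<And>t. t \<in> {-d<..<d} \<Longrightarrow> torus_proj (c t) = \<gamma> t"
      "\<And>t. t \<in> {-d<..<d} \<Longrightarrow> (c has_vector_derivative \<gamma>' t) (at t)"
    using curve_lift[OF I(1-3) vel] by metis
  have d1: "((\<lambda>t. c t $ i) has_real_derivative \<gamma>' t $ i) (at t)" if "t \<in> {-d<..<d}" for t i
    by (rule has_real_derivative_nth[OF c(2)[OF that]])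
  have "isCont (\<lambda>t. c t $ 1) 0" using DERIV_isCont[OF d1[of 0 1]] d by simp
  then have "((\<lambda>t. c t $ 1) \<longlongrightarrow> x0 $ 1) (nhds 0)" unfolding isCont_iff_tendsto_nhds d(3) .
  then have "\<forall>\<^sub>F t in nhds 0. c t $ 1 \<in> {l<..<u}"
    using x0 by (intro topological_tendstoD) auto
  then obtain e0 where e0: "e0 > 0" "\<And>t. dist t 0 < e0 \<Longrightarrow> c t $ 1 \<in> {l<..<u}"
    unfolding eventually_nhds_metric by blast
  define e where "e = min d e0"
  have e: "e > 0" "{-e<..<e} \<subseteq> {-d<..<d}" unfolding e_def using d e0 by auto
  have in_lu: "c t $ 1 \<in> {l<..<u}" if "t \<in> {-e<..<e}" for t
    using e0(2)[of t] that by (auto simp: e_def dist_real_def abs_less_iff)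
  have slope_eq: "tilt (c t $ 1) > 0 \<and> \<gamma>' t $ 1 \<noteq> 0 \<and> \<gamma>' t $ 2 = - (1 / tilt (c t $ 1)) * \<gamma>' t $ 1"
    if t: "t \<in> {-e<..<e}" for t
  proof -
    have pos: "tilt (c t $ 1) > 0" using in_lu[OF t] basin tilt_pos by blast
    have "t \<in> I" "\<gamma> t = torus_proj (c t)" using t e d c by auto
    with tang[of t] obtain s where "\<gamma>' t = s *\<^sub>R pt (tilt (c t $ 1)) (-1)" "\<gamma>' t \<noteq> 0"
      by (auto simp: mem_centre_field_iff centre_vector_def)
    with pos show ?thesis by auto
  qed
  have const: "c t $ 2 + W (c t $ 1) = c 0 $ 2 + W (c 0 $ 1)" if "t \<in> {-e<..<e}" for t
  proof (rule has_field_derivative_zero_constant[of "{-e<..<e}", THEN exE])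
    fix t assume t: "t \<in> {-e<..<e}"
    have "((\<lambda>t. c t $ 2 + W (c t $ 1)) has_real_derivative
        \<gamma>' t $ 2 + 1 / tilt (c t $ 1) * \<gamma>' t $ 1) (at t)"
      using t e in_lu[OF t] by (intro DERIV_add d1 DERIV_chain2[OF W d1]) auto
    then show "((\<lambda>t. c t $ 2 + W (c t $ 1)) has_real_derivative 0) (at t within {-e<..<e})"
      using slope_eq[OF t] by (simp add: has_field_derivative_at_within)
  next
    fix k assume "\<forall>t\<in>{-e<..<e}. c t $ 2 + W (c t $ 1) = k"
    with that e show ?thesis by auto
  qed simp
  show ?thesis
  proof (rule that[of e c "\<lambda>t. \<gamma>' t $ 1"])
    show "e > 0" "{-e<..<e} \<subseteq> I" "c 0 = x0" using e d by auto
    show "torus_proj (c t) = \<gamma> t" "((\<lambda>t. c t $ 1) has_real_derivative \<gamma>' t $ 1) (at t)"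
      "\<gamma>' t $ 1 \<noteq> 0" "c t $ 2 + W (c t $ 1) = x0 $ 2 + W (x0 $ 1)" if "t \<in> {-e<..<e}" for t
      using that e c d1 slope_eq const d(3) by auto
    show "continuous_on {-e<..<e} (\<lambda>t. \<gamma>' t $ 1)"
      using e d by (intro continuous_intros continuous_on_subset[OF I(4)]) auto
  qed
qed

text \<open>
  By the first integral a tangent curve is determined by its horizontal coordinate, which is
  locally invertible.  So any two tangent curves are reparametrisations of each other: follow the
  first one, then the inverse of the horizontal coordinate of the second.
\<close>

lemma uniquely_integrable_basin:
  assumes "x0 $ 1 \<in> basin"
  shows "uniquely_integrable_at centre_field (torus_proj x0)"
proof -
  obtain l u W where lu: "l < x0 $ 1" "x0 $ 1 < u" "{l<..<u} \<subseteq> basin"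
    and W: "\<And>z. z \<in> {l<..<u} \<Longrightarrow> (W has_real_derivative 1 / tilt z) (at z)"
    using local_primitive[OF assms] by blast
  have x0: "x0 $ 1 \<in> {l<..<u}" using lu by simp
  have "\<exists>I \<gamma>. tangent_curve centre_field (torus_proj x0) I \<gamma>"
  proof (intro exI)
    let ?I = "{l - x0 $ 1<..<u - x0 $ 1}"
    \<comment> \<open>The level curve of the first integral \<open>y + W x\<close>, parametrised by \<open>x\<close>.\<close>
    let ?c = "\<lambda>t. pt (x0 $ 1 + t) (x0 $ 2 - (W (x0 $ 1 + t) - W (x0 $ 1)))"
    let ?v = "\<lambda>t. pt 1 (- (1 / tilt (x0 $ 1 + t)))"
    show "tangent_curve centre_field (torus_proj x0) ?I (\<lambda>t. torus_proj (?c t))"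
      unfolding tangent_curve_def
    proof (intro conjI exI[of _ ?v] ballI)
      show "open ?I" "is_interval ?I" "0 \<in> ?I" using lu by auto
      show "torus_proj (?c 0) = torus_proj x0" by simp
      have pos: "tilt (x0 $ 1 + t) > 0" if "t \<in> ?I" for t
      proof -
        have "x0 $ 1 + t \<in> {l<..<u}" using that by auto
        then show ?thesis using lu tilt_pos by blast
      qed
      have "tilt (x0 $ 1 + t) \<noteq> 0" if "t \<in> ?I" for t using pos[OF that] by simp
      then show "continuous_on ?I ?v"
        by (intro continuous_intros continuous_on_compose2[OF continuous_tilt[of UNIV]]) auto
      fix t assume t: "t \<in> ?I"
      then have "x0 $ 1 + t \<in> {l<..<u}" by auto
      then have "((\<lambda>t. W (x0 $ 1 + t)) has_real_derivative 1 / tilt (x0 $ 1 + t) * 1) (at t)"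
        by (intro DERIV_chain2[OF W]) (auto intro!: derivative_eq_intros)
      then have "((\<lambda>t. x0 $ 2 - (W (x0 $ 1 + t) - W (x0 $ 1))) has_real_derivative - (1 / tilt (x0 $ 1 + t))) (at t)"
        by (auto intro!: derivative_eq_intros)
      moreover have "((\<lambda>t. x0 $ 1 + t) has_real_derivative 1) (at t)" by (auto intro!: derivative_eq_intros)
      ultimately have "(?c has_vector_derivative ?v t) (at t)" by (intro has_vector_derivative_pt)
      then show "curve_has_velocity (\<lambda>t. torus_proj (?c t)) (?v t) t" by (rule curve_has_velocity_proj)
      show "?v t \<noteq> 0" by (simp add: pt_eq_iff)
      have "?v t = (1 / tilt (x0 $ 1 + t)) *\<^sub>R centre_vector (torus_proj (?c t))"
        using pos[OF t] by (simp add: pt_eq_iff centre_vector_def)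
      then show "?v t \<in> centre_field (torus_proj (?c t))" unfolding mem_centre_field_iff by blast
    qed
  qed
  moreover have "coincide_near_0 I \<gamma> J \<eta>"
    if \<gamma>: "tangent_curve centre_field (torus_proj x0) I \<gamma>"
      and \<eta>: "tangent_curve centre_field (torus_proj x0) J \<eta>" for I \<gamma> J \<eta>
  proof -
    obtain e c \<sigma> where e: "e > 0" "{-e<..<e} \<subseteq> I" "c 0 = x0"
      and c: "\<And>t. t \<in> {-e<..<e} \<Longrightarrow> torus_proj (c t) = \<gamma> t"
        "\<And>t. t \<in> {-e<..<e} \<Longrightarrow> ((\<lambda>t. c t $ 1) has_real_derivative \<sigma> t) (at t)"
      and \<sigma>: "continuous_on {-e<..<e} \<sigma>" "\<And>t. t \<in> {-e<..<e} \<Longrightarrow> \<sigma> t \<noteq> 0"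
      and ci: "\<And>t. t \<in> {-e<..<e} \<Longrightarrow> c t $ 2 + W (c t $ 1) = x0 $ 2 + W (x0 $ 1)"
      by (rule tangent_curve_first_integral[OF \<gamma> x0 lu(3) W]) blast+
    obtain d b \<rho> where d: "d > 0" "{-d<..<d} \<subseteq> J" "b 0 = x0"
      and b: "\<And>t. t \<in> {-d<..<d} \<Longrightarrow> torus_proj (b t) = \<eta> t"
        "\<And>t. t \<in> {-d<..<d} \<Longrightarrow> ((\<lambda>t. b t $ 1) has_real_derivative \<rho> t) (at t)"
      and \<rho>: "continuous_on {-d<..<d} \<rho>" "\<And>t. t \<in> {-d<..<d} \<Longrightarrow> \<rho> t \<noteq> 0"
      and bi: "\<And>t. t \<in> {-d<..<d} \<Longrightarrow> b t $ 2 + W (b t $ 1) = x0 $ 2 + W (x0 $ 1)"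
      by (rule tangent_curve_first_integral[OF \<eta> x0 lu(3) W]) blast+
    obtain r g where r: "r > 0" and g0: "g (b 0 $ 1) = 0"
      and g: "\<And>y. y \<in> ball (b 0 $ 1) r \<Longrightarrow> g y \<in> {-d<..<d} \<and> b (g y) $ 1 = y"
        "\<And>y. y \<in> ball (b 0 $ 1) r \<Longrightarrow> (g has_real_derivative 1 / \<rho> (g y)) (at y)"
      by (rule local_inverse_real[OF d(1) b(2) \<rho>(2)]) blast+
    have "isCont (\<lambda>t. c t $ 1) 0" using DERIV_isCont[OF c(2)[of 0]] e by simp
    then have "((\<lambda>t. c t $ 1) \<longlongrightarrow> x0 $ 1) (nhds 0)" unfolding isCont_iff_tendsto_nhds e(3) .
    then have "\<forall>\<^sub>F t in nhds 0. c t $ 1 \<in> ball (b 0 $ 1) r"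
      using r d(3) by (intro topological_tendstoD) auto
    then obtain e0 where e0: "e0 > 0" "\<And>t. dist t 0 < e0 \<Longrightarrow> c t $ 1 \<in> ball (b 0 $ 1) r"
      unfolding eventually_nhds_metric by blast
    define \<delta> where "\<delta> = min e e0"
    have \<delta>: "\<delta> > 0" "{-\<delta><..<\<delta>} \<subseteq> {-e<..<e}" unfolding \<delta>_def using e e0 by auto
    have near: "c t $ 1 \<in> ball (b 0 $ 1) r" if "t \<in> {-\<delta><..<\<delta>}" for t
      using e0(2)[of t] that by (auto simp: \<delta>_def dist_real_def abs_less_iff)
    let ?h = "\<lambda>t. g (c t $ 1)"
    let ?h' = "\<lambda>t. 1 / \<rho> (?h t) * \<sigma> t"
    have dh: "(?h has_real_derivative ?h' t) (at t)" if "t \<in> {-\<delta><..<\<delta>}" for t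
      by (rule DERIV_chain2[OF g(2)[OF near[OF that]] c(2)]) (use that \<delta> in auto)
    have h_in: "?h t \<in> {-d<..<d}" if "t \<in> {-\<delta><..<\<delta>}" for t
      using g(1)[OF near[OF that]] by blast
    show "coincide_near_0 I \<gamma> J \<eta>"
      unfolding coincide_near_0_def
    proof (rule exI[of _ \<delta>], rule conjI[OF \<delta>(1)], rule exI[of _ ?h], rule exI[of _ ?h'], intro conjI ballI)
      show "?h 0 = 0" using g0 d(3) e(3) by simp
      have "continuous_on {-\<delta><..<\<delta>} ?h"
        using dh DERIV_isCont by (blast intro: continuous_at_imp_continuous_on)
      then have "continuous_on {-\<delta><..<\<delta>} (\<lambda>t. \<rho> (?h t))"
        by (rule continuous_on_compose2[OF \<rho>(1)]) (use h_in in blast)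
      moreover have "continuous_on {-\<delta><..<\<delta>} \<sigma>" by (rule continuous_on_subset[OF \<sigma>(1) \<delta>(2)])
      ultimately show "continuous_on {-\<delta><..<\<delta>} ?h'"
        using h_in \<rho>(2) by (intro continuous_intros) blast+
      fix t assume t: "t \<in> {-\<delta><..<\<delta>}"
      then have te: "t \<in> {-e<..<e}" using \<delta> by blast
      show "(?h has_real_derivative ?h' t) (at t)" by (rule dh[OF t])
      show "?h' t \<noteq> 0" using \<sigma>(2)[OF te] \<rho>(2)[OF h_in[OF t]] by simp
      show "t \<in> I" using te e by blast
      show "?h t \<in> J" using h_in[OF t] d by blast
      have "b (?h t) $ 1 = c t $ 1" using g(1)[OF near[OF t]] by blast
      moreover from this have "b (?h t) $ 2 = c t $ 2" using bi[OF h_in[OF t]] ci[OF te] by simp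
      ultimately have "b (?h t) = c t" by (simp add: pt_eq_iff)
      then show "\<gamma> t = \<eta> (?h t)" using c(1)[OF te] b(1)[OF h_in[OF t]] by simp
    qed
  qed
  ultimately show ?thesis unfolding uniquely_integrable_at_def by blast
qed

section \<open>Branching circles\<close>

lemma tangent_curve_of_solution:
  assumes "d > 0" and "\<And>t. t \<in> {-d<..<d} \<Longrightarrow> (\<xi> has_real_derivative tilt (\<xi> t)) (at t)"
  shows "tangent_curve centre_field (torus_proj (pt (\<xi> 0) y)) {-d<..<d} (\<lambda>t. torus_proj (pt (\<xi> t) (y - t)))"
  unfolding tangent_curve_def
proof (intro conjI exI[of _ "\<lambda>t. pt (tilt (\<xi> t)) (-1)"] ballI)
  show "open {-d<..<d}" "is_interval {-d<..<d}" "0 \<in> {-d<..<d}" using assms(1) by auto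
  show "torus_proj (pt (\<xi> 0) (y - 0)) = torus_proj (pt (\<xi> 0) y)" by simp
  have "continuous_on {-d<..<d} \<xi>"
    using assms(2) DERIV_isCont by (blast intro: continuous_at_imp_continuous_on)
  then show "continuous_on {-d<..<d} (\<lambda>t. pt (tilt (\<xi> t)) (-1))"
    by (intro continuous_intros continuous_on_compose2[OF continuous_tilt[of UNIV]]) auto
  fix t assume "t \<in> {-d<..<d}"
  then have "((\<lambda>t. pt (\<xi> t) (y - t)) has_vector_derivative pt (tilt (\<xi> t)) (-1)) (at t)"
    by (intro has_vector_derivative_pt assms(2)) (auto intro!: derivative_eq_intros)
  then show "curve_has_velocity (\<lambda>t. torus_proj (pt (\<xi> t) (y - t))) (pt (tilt (\<xi> t)) (-1)) t"
    by (rule curve_has_velocity_proj)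
  show "pt (tilt (\<xi> t)) (-1) \<noteq> 0" by (simp add: pt_eq_iff)
  show "pt (tilt (\<xi> t)) (-1) \<in> centre_field (torus_proj (pt (\<xi> t) (y - t)))"
    unfolding mem_centre_field_iff by (intro exI[of _ 1]) (simp add: centre_vector_def)
qed

text \<open>
  The branch \<open>\<xi>\<close> is compared with the vertical line over \<open>z\<close>.  At negative times its horizontal
  coordinate lies strictly between \<open>z - 1\<close> and \<open>z\<close>, so it is not on the line even modulo
  the lattice.
\<close>

lemma not_uniquely_integrable_branch:
  assumes "left_primitive z e W" "z \<notin> basin"
  shows "\<not> uniquely_integrable_at centre_field (torus_proj (pt z y))"
proof
  assume unique: "uniquely_integrable_at centre_field (torus_proj (pt z y))"
  obtain \<xi> d where d: "d > 0" "\<xi> 0 = z"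
    and \<xi>: "\<And>t. t \<in> {-d<..<d} \<Longrightarrow> (\<xi> has_real_derivative tilt (\<xi> t)) (at t)"
      "\<And>t. t \<in> {-d<..<0} \<Longrightarrow> z - 1 < \<xi> t \<and> \<xi> t < z"
    by (rule branch[OF assms]) blast
  let ?\<gamma> = "\<lambda>t. torus_proj (pt (\<xi> t) (y - t))" and ?\<eta> = "\<lambda>t. torus_proj (pt z (y - t))"
  have "tangent_curve centre_field (torus_proj (pt z y)) {-d<..<d} ?\<gamma>"
    using tangent_curve_of_solution[OF d(1) \<xi>(1)] d(2) by simp
  moreover have "tangent_curve centre_field (torus_proj (pt z y)) {-1<..<1} ?\<eta>"
    by (rule tangent_curve_of_solution[of 1 "\<lambda>_. z"]) (simp_all add: tilt_outside[OF assms(2)])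
  ultimately have "coincide_near_0 {-d<..<d} ?\<gamma> {-1<..<1} ?\<eta>"
    using unique unfolding uniquely_integrable_at_def by blast
  then obtain \<delta> h where \<delta>: "\<delta> > 0" "\<forall>t\<in>{-\<delta><..<\<delta>}. t \<in> {-d<..<d} \<and> ?\<gamma> t = ?\<eta> (h t)"
    unfolding coincide_near_0_def by blast
  define t where "t = - \<delta> / 2"
  have t: "t \<in> {-\<delta><..<\<delta>}" "t < 0" unfolding t_def using \<delta> by auto
  then have "t \<in> {-d<..<0}" "?\<gamma> t = ?\<eta> (h t)" using \<delta>(2) by auto
  then have "\<xi> t - z \<in> \<int>" "z - 1 < \<xi> t" "\<xi> t < z"
    using \<xi>(2) by (simp_all add: torus_proj_eq_iff same_mod_lattice_iff)
  then obtain k where "\<xi> t - z = of_int k" "-1 < \<xi> t - z" "\<xi> t - z < 0" by (auto elim: Ints_cases)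
  then show False by simp
qed

definition vertical_circle :: "real \<Rightarrow> torus set" where
  "vertical_circle z = range (\<lambda>t. torus_proj (pt z t))"

lemma circle_vertical_circle: "circle_in_torus (vertical_circle z)"
  unfolding circle_in_torus_def
proof (intro exI[of _ "\<lambda>t. torus_proj (pt z t)"] exI[of _ "\<lambda>_. pt 0 1"] conjI allI)
  show "curve_has_velocity (\<lambda>t. torus_proj (pt z t)) (pt 0 1) t" for t
    by (intro curve_has_velocity_proj has_vector_derivative_pt) (auto intro!: derivative_eq_intros)
  show "pt 0 1 \<noteq> 0" by (simp add: pt_eq_iff)
  show "torus_proj (pt z s) = torus_proj (pt z t) \<longleftrightarrow> s - t \<in> \<int>" for s t
    by (simp add: torus_proj_eq_iff same_mod_lattice_iff)
qed (auto simp: vertical_circle_def)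

definition basin_annuli :: "torus set" where
  "basin_annuli = torus_proj ` {x. x $ 1 \<in> basin}"

lemma open_basin_annuli: "open basin_annuli"
proof -
  have "open ((\<lambda>x::real^2. x $ 1) -` basin)"
    by (intro open_vimage open_basin continuous_intros)
  then show ?thesis unfolding basin_annuli_def by (intro open_image_torus_proj) (simp add: vimage_def)
qed

lemma basin_annuli_dense: "closure basin_annuli = UNIV"
proof -
  have "basin_annuli \<inter> U \<noteq> {}" if U: "open U" "p \<in> U" for U p
  proof -
    obtain x where p: "p = torus_proj x" by (rule torus_cases)
    have "isCont (\<lambda>t. pt (x $ 1 + t) (x $ 2)) 0" by (intro continuous_intros)
    then have "((\<lambda>t. pt (x $ 1 + t) (x $ 2)) \<longlongrightarrow> x) (nhds 0)" by (simp add: isCont_iff_tendsto_nhds)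
    then have "\<forall>\<^sub>F t in nhds 0. pt (x $ 1 + t) (x $ 2) \<in> torus_proj -` U"
      using U p open_vimage_torus_proj by (intro topological_tendstoD) auto
    then obtain e where e: "e > 0" "\<And>t. dist t 0 < e \<Longrightarrow> pt (x $ 1 + t) (x $ 2) \<in> torus_proj -` U"
      unfolding eventually_nhds_metric by blast
    obtain z where z: "z \<in> basin" "x $ 1 < z" "z < x $ 1 + e"
      using basin_dense[of "x $ 1" "x $ 1 + e"] e(1) by auto
    have "torus_proj (pt z (x $ 2)) \<in> U" using e(2)[of "z - x $ 1"] z by (simp add: dist_real_def)
    moreover have "torus_proj (pt z (x $ 2)) \<in> basin_annuli" unfolding basin_annuli_def using z by auto
    ultimately show ?thesis by blast
  qed
  from this[of "- closure basin_annuli"] show ?thesis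
    using closure_subset[of basin_annuli] closed_closure[of basin_annuli] by blast
qed

theorem theorem1:
  shows "\<exists>(f :: torus \<Rightarrow> torus) (E :: torus \<Rightarrow> (real^2) set).
    partially_hyperbolic f \<and>
    (\<exists>L. expanding_linear_map L \<and> homotopic_with_canon (\<lambda>_. True) UNIV UNIV f L) \<and>
    centre_direction f E \<and>
    \<not> uniquely_integrable E \<and>
    (\<exists>U. open U \<and> closure U = UNIV \<and> uniquely_integrable_on E U) \<and>
    (\<exists>\<C>. infinite \<C> \<and> countable \<C> \<and> (\<forall>S\<in>\<C>. circle_in_torus S) \<and>
       (\<forall>S\<in>\<C>. \<forall>p\<in>S. \<not> uniquely_integrable_at E p))"
proof -
  obtain Z where Z: "infinite Z" "countable Z"
    "\<And>x y. x \<in> Z \<Longrightarrow> y \<in> Z \<Longrightarrow> x - y \<in> \<int> \<Longrightarrow> x = y"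
    "\<And>z. z \<in> Z \<Longrightarrow> z \<notin> basin" "\<And>z. z \<in> Z \<Longrightarrow> \<exists>e W. left_primitive z e W"
    using branch_points by blast
  let ?\<C> = "vertical_circle ` Z"
  have branching: "\<not> uniquely_integrable_at centre_field p" if "S \<in> ?\<C>" "p \<in> S" for S p
    using that Z(4,5) not_uniquely_integrable_branch by (fastforce simp: vertical_circle_def)
  have "inj_on vertical_circle Z"
  proof (rule inj_onI)
    fix x y assume xy: "x \<in> Z" "y \<in> Z" "vertical_circle x = vertical_circle y"
    have "torus_proj (pt x 0) \<in> vertical_circle x" by (simp add: vertical_circle_def)
    then obtain t where "torus_proj (pt x 0) = torus_proj (pt y t)"
      unfolding xy(3) by (auto simp: vertical_circle_def)
    then have "x - y \<in> \<int>" by (simp add: torus_proj_eq_iff same_mod_lattice_iff)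
    with xy Z(3) show "x = y" by blast
  qed
  then have "infinite ?\<C>" using Z(1) by (simp add: finite_image_iff)
  then have circles: "\<exists>\<C>. infinite \<C> \<and> countable \<C> \<and> (\<forall>S\<in>\<C>. circle_in_torus S) \<and>
      (\<forall>S\<in>\<C>. \<forall>p\<in>S. \<not> uniquely_integrable_at centre_field p)"
    using Z(2) circle_vertical_circle branching by (intro exI[of _ ?\<C>]) auto
  obtain z where "z \<in> Z" using Z(1) by (metis finite.emptyI ex_in_conv)
  then have "\<not> uniquely_integrable_at centre_field (torus_proj (pt z 0))"
    using branching[of "vertical_circle z"] by (auto simp: vertical_circle_def)
  then have not_everywhere: "\<not> uniquely_integrable centre_field"
    unfolding uniquely_integrable_on_def by blast
  have "uniquely_integrable_on centre_field basin_annuli"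
    unfolding uniquely_integrable_on_def basin_annuli_def using uniquely_integrable_basin by blast
  then have dense: "\<exists>U. open U \<and> closure U = UNIV \<and> uniquely_integrable_on centre_field U"
    using open_basin_annuli basin_annuli_dense by blast
  have linear: "\<exists>L. expanding_linear_map L \<and> homotopic_with_canon (\<lambda>_. True) UNIV UNIV torus_map L"
    using expanding_linear_part torus_map_homotopic by blast
  show ?thesis
    by (rule exI[of _ torus_map], rule exI[of _ centre_field])
      (intro conjI partially_hyperbolic_torus_map linear centre_direction_torus_map not_everywhere dense circles)
qed

end
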